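(* For all positive integers $d_1,s$, there are positive constants $C=C(d_1,s)$ and $c=c(d_1,s)$ such that the following holds for every integer $d_2>d_1$. Let $\rho$ be a random state on $\mathbf{C}^{d_1}\otimes\mathbf{C}^{d_2}$ with distribution $\mu_{d_1d_2,s}$. Then: (1) If $s<d_1^2$, then $\mathbf{P}\left(\|\rho^R\|_1>1\right)\ge 1-C\exp\left(-c\,d_2^{1/4}\right)$. (2) If $s>d_1^2$, then $\mathbf{P}\left(\|\rho^R\|_1\le 1\right)\ge 1-C\exp\left(-c\,d_2^{1/4}\right)$.
   Context: A state on a finite-dimensional complex Hilbert space is a positive semidefinite operator of trace $1$. Random states: for positive integers $n,s$, $\mu_{n,s}$ denotes the distribution of the random state $\mathrm{Tr}_{\mathbf{C}^s}|\psi\rangle\langle\psi|$ on $\mathbf{C}^n$ (partial trace over the second factor), where $\psi$ is uniformly distributed on the unit sphere of $\mathbf{C}^n\otimes\mathbf{C}^s$. For $n=d_1d_2$, $\mathbf{C}^n$ is identified with $\mathbf{C}^{d_1}\otimes\mathbf{C}^{d_2}$. Realignment: let $\{e_i\}_{i=1}^{d_1}$ and $\{f_j\}_{j=1}^{d_2}$ be the canonical bases of $\mathbf{C}^{d_1}$ and $\mathbf{C}^{d_2}$. For an operator $A=\sum_{i,k=1}^{d_1}\sum_{j,l=1}^{d_2}A_{ij,kl}\,|e_i\otimes f_j\rangle\langle e_k\otimes f_l|$ on $\mathbf{C}^{d_1}\otimes\mathbf{C}^{d_2}$, its realignment is the $d_1^2\times d_2^2$ matrix $A^R=\sum_{i,k=1}^{d_1}\sum_{j,l=1}^{d_2}A_{ij,kl}\,|e_i\otimes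 e_k\rangle\langle f_j\otimes f_l|$. $\|\cdot\|_1$ denotes the trace norm (sum of singular values). *)

theory Defs
  imports "HOL-Probability.Probability" "Jordan_Normal_Form.Schur_Decomposition"
begin

hide_const (open) Finite_Cartesian_Product.vec Finite_Cartesian_Product.vec_nth
  Finite_Cartesian_Product.mat
no_notation Finite_Cartesian_Product.vec_nth (infixl "$" 90)

text \<open>
  Vectors and operators on \<open>C^n\<close> are complex vectors and matrices in the canonical basis, indexed
  from 0. In a tensor product \<open>C^m \<otimes> C^n\<close>, identified with \<open>C^(m * n)\<close>, the basis vector
  \<open>e_i \<otimes> f_j\<close> has index \<open>i * n + j\<close>.

  The Borel sigma-algebras on vectors and on matrices of fixed size are those generated by the entries.
\<close>

definition borel_vec :: "nat \<Rightarrow> complex vec measure" where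
  "borel_vec n = vimage_algebra (carrier_vec n) (\<lambda>v. \<lambda>i\<in>{..<n}. v $ i) (\<Pi>\<^sub>M i\<in>{..<n}. borel)"

definition borel_mat :: "nat \<Rightarrow> nat \<Rightarrow> complex mat measure" where
  "borel_mat m n = vimage_algebra (carrier_mat m n) (\<lambda>A. \<lambda>ij\<in>{..<m} \<times> {..<n}. A $$ ij)
     (\<Pi>\<^sub>M ij\<in>{..<m} \<times> {..<n}. borel)"

text \<open>
  The uniform distribution on the unit sphere of \<open>C^n\<close> is the law of \<open>x / |x|\<close>, where \<open>x\<close> is uniform
  (with respect to Lebesgue measure) in the closed unit ball of \<open>C^n\<close>. The point \<open>x = 0\<close>, which
  \<open>x / 0 = 0\<close> sends to the origin, is a null set for \<open>n > 0\<close>.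
\<close>

definition unit_ball :: "nat \<Rightarrow> (nat \<Rightarrow> complex) set" where
  "unit_ball n = {x \<in> {..<n} \<rightarrow>\<^sub>E UNIV. L2_set (\<lambda>i. cmod (x i)) {..<n} \<le> 1}"

definition uniform_sphere :: "nat \<Rightarrow> complex vec measure" where
  "uniform_sphere n =
     distr (uniform_measure (\<Pi>\<^sub>M i\<in>{..<n}. lborel) (unit_ball n)) (borel_vec n)
       (\<lambda>x. vec n (\<lambda>i. x i / of_real (L2_set (\<lambda>i. cmod (x i)) {..<n})))"

definition ket_bra :: "complex vec \<Rightarrow> complex mat" where
  "ket_bra \<psi> = mat (dim_vec \<psi>) (dim_vec \<psi>) (\<lambda>(i, j). \<psi> $ i * cnj (\<psi> $ j))"

definition partial_trace_snd :: "nat \<Rightarrow> nat \<Rightarrow> complex mat \<Rightarrow> complex mat" where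
  "partial_trace_snd n s A = mat n n (\<lambda>(i, j). \<Sum>k<s. A $$ (i * s + k, j * s + k))"

definition random_state :: "nat \<Rightarrow> nat \<Rightarrow> complex mat measure" where
  "random_state n s =
     distr (uniform_sphere (n * s)) (borel_mat n n) (\<lambda>\<psi>. partial_trace_snd n s (ket_bra \<psi>))"

text \<open>
  Row \<open>r\<close> of the realignment stands for \<open>e_i \<otimes> e_k\<close>, i.e. \<open>r = i * d1 + k\<close>, and column \<open>c\<close> stands for
  \<open>f_j \<otimes> f_l\<close>, i.e. \<open>c = j * d2 + l\<close>.
\<close>

definition realign :: "nat \<Rightarrow> nat \<Rightarrow> complex mat \<Rightarrow> complex mat" where
  "realign d1 d2 A = mat (d1\<^sup>2) (d2\<^sup>2) (\<lambda>(r, c).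
     let i = r div d1; k = r mod d1; j = c div d2; l = c mod d2
     in A $$ (i * d2 + j, k * d2 + l))"

text \<open>
  The singular values are the square roots of the eigenvalues of \<open>A* A\<close>, with algebraic multiplicity.
  These eigenvalues are nonnegative reals, so that \<open>Re\<close> only changes the type. There are
  \<open>dim_col A\<close> of them; the surplus ones of a wide matrix are zeros and do not affect the trace norm.
\<close>

definition singular_values :: "complex mat \<Rightarrow> real multiset" where
  "singular_values A =
     image_mset (\<lambda>e. sqrt (Re e)) (proots (char_poly (mat_adjoint A * A)))"

definition trace_norm :: "complex mat \<Rightarrow> real" where
  "trace_norm A = sum_mset (singular_values A)"

end

theory Submission
  imports Defs
begin

text \<open>
  Write the random unit vector as \<open>\<psi> = \<Sum> e_i \<otimes> x_ia \<otimes> g_a\<close> with \<open>d1 * s\<close> rows \<open>x_ia\<close> in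
  \<open>C^d2\<close>, and let \<open>G\<close> be the Gram matrix of these rows, a matrix of size \<open>d1 * s\<close> and trace 1. The
  matrix \<open>H = \<rho>^R (\<rho>^R)*\<close> has size \<open>d1^2\<close> and is a quadratic expression in \<open>G\<close>:
  \<open>H_{ik,i'k'} = \<Sum>_{a,b} G_{ia,i'b} cnj G_{ka,k'b}\<close> (\<open>realign_gram_index\<close>). So the trace norm of
  \<open>\<rho>^R\<close> is governed by \<open>G\<close> alone, whose size does not grow with \<open>d2\<close>. For large \<open>d2\<close> the rows are nearly
  orthogonal and of nearly equal length, that is, \<open>G\<close> is close to \<open>1 / (d1 * s)\<close> times the identity.
  For exactly this \<open>G\<close> one gets \<open>H = 1 / (d1^2 * s)\<close> times the identity and hence
  trace norm \<open>d1^2 * sqrt (1 / (d1^2 * s)) = d1 / sqrt s\<close>, which exceeds 1 if \<open>s < d1^2\<close> and is below 1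
  if \<open>s > d1^2\<close>. Two things remain: that \<open>G\<close> concentrates, and that the comparison with 1 survives a
  small perturbation of \<open>G\<close>.

  Concentration (\<open>random_state_prob\<close>). Closeness of \<open>G\<close> to a multiple of the identity, measured
  relative to \<open>tr G\<close>, is invariant under scaling of \<open>\<psi>\<close>. On a scale-invariant set the uniform measure on
  the ball and the standard Gaussian measure agree, because the Gaussian density is a mixture of
  indicator functions of balls (\<open>emeasure_cone_inter_ball\<close>). Under the Gaussian measure the coordinates are
  independent, the exponential moments of the entries of \<open>G\<close> are explicit, and Chernoff's bound with a union
  bound over the entries gives a failure probability of at most \<open>4 (d1 s)^2 exp (- c d2)\<close>
  (\<open>not_near_isotropic_prob\<close>). Finally \<open>d2 \<ge> d2^(1/4)\<close>.

  Perturbation. Both estimates of the trace norm use only traces, which are polynomials in the entries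
  of \<open>G\<close>: the lower one \<open>tr sqrt H \<ge> a * tr H - b * tr H^2\<close> comes from a scalar inequality that is
  an equality at the limiting eigenvalue (\<open>trace_norm_lower\<close>), the upper one \<open>(tr sqrt H)^2 \<le> d1^2 * tr H\<close>
  is the Cauchy-Schwarz inequality (\<open>trace_norm_upper\<close>); both are sharp when \<open>H\<close> is a multiple of the
  identity. By continuity there is a neighbourhood of \<open>1 / (d1 * s)\<close> times the identity, independent of \<open>d2\<close>,
  in which the comparison with 1 persists.

  A statement about the probability of the event also needs the event to be measurable, and the
  singular values are defined through the roots of a characteristic polynomial. The trace norm is a pointwise
  limit of polynomial expressions in the numbers \<open>tr ((A* A)^i)\<close> (\<open>trace_norm_tendsto\<close>), which settles
  measurability. Since \<open>A* A\<close> and \<open>A A*\<close> have the same traces of positive powers, the same limit shows that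
  \<open>A\<close> and \<open>A*\<close> have equal trace norms, so that one may work with the small matrix \<open>H\<close>.
\<close>

section \<open>Power sums of eigenvalues and the trace norm\<close>

definition mtrace :: "complex mat \<Rightarrow> complex" where
  "mtrace A = (\<Sum>i<dim_row A. A $$ (i, i))"

lemma mtrace_comm:
  assumes "A \<in> carrier_mat m n" "B \<in> carrier_mat n m"
  shows "mtrace (A * B) = mtrace (B * A)"
proof -
  have "mtrace (A * B) = (\<Sum>i<m. \<Sum>j<n. A $$ (i, j) * B $$ (j, i))"
    unfolding mtrace_def using assms by (auto simp: scalar_prod_def atLeast0LessThan intro!: sum.cong)
  also have "\<dots> = (\<Sum>j<n. \<Sum>i<m. B $$ (j, i) * A $$ (i, j))"
    by (subst sum.swap) (simp add: mult.commute)
  also have "\<dots> = mtrace (B * A)"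
    unfolding mtrace_def using assms by (auto simp: scalar_prod_def atLeast0LessThan intro!: sum.cong)
  finally show ?thesis .
qed

lemma mat_adjoint_carrier [simp, intro]:
  "A \<in> carrier_mat m n \<Longrightarrow> mat_adjoint A \<in> carrier_mat n m"
  unfolding mat_adjoint_def by auto

lemma mat_adjoint_index [simp]:
  "i < dim_col A \<Longrightarrow> j < dim_row A \<Longrightarrow> mat_adjoint A $$ (i, j) = cnj (A $$ (j, i))"
  for A :: "complex mat"
  unfolding mat_adjoint_def mat_of_rows_def by simp

lemma mat_adjoint_dim [simp]:
  "dim_row (mat_adjoint A) = dim_col A" "dim_col (mat_adjoint A) = dim_row A"
  unfolding mat_adjoint_def by auto

lemma gram_carrier [simp]:
  fixes A :: "complex mat"
  assumes "A \<in> carrier_mat m n"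
  shows "mat_adjoint A * A \<in> carrier_mat n n" "A * mat_adjoint A \<in> carrier_mat m m"
  using mult_carrier_mat[OF mat_adjoint_carrier[OF assms] assms]
        mult_carrier_mat[OF assms mat_adjoint_carrier[OF assms]] by auto

lemma upper_triangular_pow:
  fixes B :: "complex mat"
  assumes B: "B \<in> carrier_mat n n" and ut: "upper_triangular B"
  shows "upper_triangular (B ^\<^sub>m k) \<and> (\<forall>i<n. (B ^\<^sub>m k) $$ (i, i) = B $$ (i, i) ^ k)"
proof (induction k)
  case 0
  show ?case using B by auto
next
  case (Suc k)
  have Bk: "B ^\<^sub>m k \<in> carrier_mat n n" using B by simp
  have e: "(B ^\<^sub>m Suc k) $$ (i, j) = (\<Sum>l<n. (B ^\<^sub>m k) $$ (i, l) * B $$ (l, j))"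
    if "i < n" "j < n" for i j
    using that B Bk by (auto simp: scalar_prod_def atLeast0LessThan intro!: sum.cong)
  have 1: "(B ^\<^sub>m Suc k) $$ (i, j) = 0" if "i < n" "j < i" for i j
  proof -
    have "(B ^\<^sub>m k) $$ (i, l) * B $$ (l, j) = 0" if "l < n" for l
      using that \<open>i < n\<close> \<open>j < i\<close> Suc ut B Bk
      by (cases "l < i") (auto simp: upper_triangular_def)
    thus ?thesis using that by (subst e) (auto intro!: sum.neutral)
  qed
  have 2: "(B ^\<^sub>m Suc k) $$ (i, i) = B $$ (i, i) ^ Suc k" if "i < n" for i
  proof -
    have "(\<Sum>l<n. (B ^\<^sub>m k) $$ (i, l) * B $$ (l, i)) =
          (\<Sum>l<n. if l = i then B $$ (i, i) ^ Suc k else 0)"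
    proof (rule sum.cong)
      fix l assume l: "l \<in> {..<n}"
      consider "l < i" | "l = i" | "i < l" by linarith
      thus "(B ^\<^sub>m k) $$ (i, l) * B $$ (l, i) = (if l = i then B $$ (i, i) ^ Suc k else 0)"
        using that l Suc ut B Bk by cases (auto simp: upper_triangular_def)
    qed simp
    thus ?thesis using that by (subst e) auto
  qed
  show ?case
    using 1 2 Bk B unfolding upper_triangular_def by auto
qed

text \<open>
  Schur triangularisation: the powers of a triangular matrix carry the powers of the eigenvalues on
  their diagonals, and the trace is invariant under similarity.
\<close>

lemma sum_eigenvalues_power:
  fixes A :: "complex mat"
  assumes A: "A \<in> carrier_mat n n"
  shows "(\<Sum>e\<in>#proots (char_poly A). e ^ k) = mtrace (A ^\<^sub>m k)"
proof -
  obtain es where es: "char_poly A = (\<Prod>e\<leftarrow>es. [:-e, 1:])" "length es = n"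
    using char_poly_factorized[OF A] by blast
  obtain B P Q where dec: "schur_decomposition A es = (B, P, Q)"
    by (cases "schur_decomposition A es") auto
  have sim: "similar_mat_wit A B P Q" and ut: "upper_triangular B" and diag: "diag_mat B = es"
    using schur_decomposition[OF A es(1) dec] by auto
  have sd: "A ^\<^sub>m k = P * (B ^\<^sub>m k) * Q" by (rule similar_mat_wit_pow_id[OF sim])
  have c: "B \<in> carrier_mat n n" "P \<in> carrier_mat n n" "Q \<in> carrier_mat n n" "Q * P = 1\<^sub>m n"
    using similar_mat_witD2[OF A sim] by auto
  have Bk: "B ^\<^sub>m k \<in> carrier_mat n n" using c by simp
  have "mtrace (A ^\<^sub>m k) = mtrace (P * ((B ^\<^sub>m k) * Q))"
    unfolding sd using c Bk by (simp add: assoc_mult_mat[of _ n n _ n _ n])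
  also have "\<dots> = mtrace (((B ^\<^sub>m k) * Q) * P)"
    by (rule mtrace_comm[of _ n n]) (use c Bk in auto)
  also have "\<dots> = mtrace (B ^\<^sub>m k)"
    using c Bk by (simp add: assoc_mult_mat[of _ n n _ n _ n])
  also have "\<dots> = (\<Sum>i<n. B $$ (i, i) ^ k)"
    unfolding mtrace_def using upper_triangular_pow[OF c(1) ut, of k] Bk by (auto intro!: sum.cong)
  also have "\<dots> = (\<Sum>e\<leftarrow>es. e ^ k)"
    using diag c(1) unfolding diag_mat_def
    by (auto simp: sum_list_sum_nth atLeast0LessThan)
  also have "\<dots> = (\<Sum>e\<in>#mset es. e ^ k)"
    by (metis mset_map sum_mset_sum_list)
  also have "mset es = proots (char_poly A)"
  proof -
    have "proots (\<Prod>p\<leftarrow>map (\<lambda>e. [:-e, 1:]) es. p) = (\<Sum>p\<leftarrow>map (\<lambda>e. [:-e, 1:]) es. proots p)"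
      by (rule proots_prod_list) auto
    also have "\<dots> = mset es" by (induction es) auto
    finally show ?thesis by (simp add: es(1))
  qed
  finally show ?thesis by simp
qed

text \<open>
  For an eigenvector \<open>v\<close> one has \<open>e * |v|^2 = <A* A v, v> = |A v|^2\<close>.
\<close>

lemma eigenvalue_gram_nonneg:
  fixes A :: "complex mat"
  assumes A: "A \<in> carrier_mat m n" and e: "e \<in># proots (char_poly (mat_adjoint A * A))"
  shows "Re e \<ge> 0" "e = of_real (Re e)"
proof -
  let ?B = "mat_adjoint A * A"
  have B: "?B \<in> carrier_mat n n" using A by simp
  have "char_poly ?B \<noteq> 0" using degree_monic_char_poly[OF B] by auto
  hence "eigenvalue ?B e" using e by (simp add: eigenvalue_root_char_poly[OF B])
  then obtain v where v: "v \<in> carrier_vec n" "v \<noteq> 0\<^sub>v n" "?B *\<^sub>v v = e \<cdot>\<^sub>v v"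
    using B unfolding eigenvalue_def eigenvector_def by auto
  \<comment> \<open>The identity <A* w, v> = <w, A v> is checked in coordinates.\<close>
  define w where "w = A *\<^sub>v v"
  have w: "w \<in> carrier_vec m" using A v unfolding w_def by simp
  have Bv: "?B *\<^sub>v v = mat_adjoint A *\<^sub>v w"
    unfolding w_def using A v(1) by (simp add: assoc_mult_mat_vec[of _ n m _ n])
  have ev: "e * v $ i = (\<Sum>r<m. cnj (A $$ (r, i)) * w $ r)" if "i < n" for i
  proof -
    have "e * v $ i = (?B *\<^sub>v v) $ i" using v that by simp
    also have "\<dots> = (\<Sum>r<m. cnj (A $$ (r, i)) * w $ r)"
      unfolding Bv using that A w by (auto simp: scalar_prod_def atLeast0LessThan intro!: sum.cong)
    finally show ?thesis .
  qed
  have wr: "w $ r = (\<Sum>i<n. A $$ (r, i) * v $ i)" if "r < m" for r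
    unfolding w_def using that A v by (auto simp: scalar_prod_def atLeast0LessThan intro!: sum.cong)
  define V W where "V = (\<Sum>i<n. (cmod (v $ i))\<^sup>2)" and "W = (\<Sum>r<m. (cmod (w $ r))\<^sup>2)"
  have "e * of_real V = (\<Sum>i<n. e * v $ i * cnj (v $ i))"
    unfolding V_def by (simp add: sum_distrib_left complex_norm_square mult.assoc del: of_real_power)
  also have "\<dots> = (\<Sum>i<n. \<Sum>r<m. cnj (A $$ (r, i)) * w $ r * cnj (v $ i))"
    by (intro sum.cong refl) (simp add: ev sum_distrib_right)
  also have "\<dots> = (\<Sum>r<m. w $ r * cnj (\<Sum>i<n. A $$ (r, i) * v $ i))"
    by (subst sum.swap) (simp add: sum_distrib_left mult_ac)
  also have "\<dots> = (\<Sum>r<m. w $ r * cnj (w $ r))"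
    by (intro sum.cong refl) (simp add: wr)
  also have "\<dots> = of_real W"
    unfolding W_def by (simp add: complex_norm_square del: of_real_power)
  finally have eq: "e * of_real V = of_real W" .
  have "V \<noteq> 0"
  proof
    assume "V = 0"
    hence "\<forall>i\<in>{..<n}. (cmod (v $ i))\<^sup>2 = 0"
      unfolding V_def by (subst (asm) sum_nonneg_eq_0_iff) auto
    hence "v = 0\<^sub>v n" using v(1) by (intro eq_vecI) auto
    thus False using v(2) by simp
  qed
  hence "e = of_real (W / V)" using eq by (simp add: field_simps)
  moreover have "W / V \<ge> 0" unfolding W_def V_def by (intro divide_nonneg_nonneg sum_nonneg) auto
  ultimately show "Re e \<ge> 0" "e = of_real (Re e)" by auto
qed

text \<open>
  Polynomials that increase to the square root on \<open>[0, 1]\<close>. They have no constant term, so that their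
  sums over the eigenvalues of a matrix involve only traces of positive powers.
\<close>

fun sqrt_poly :: "nat \<Rightarrow> real poly" where
  "sqrt_poly 0 = 0"
| "sqrt_poly (Suc k) = sqrt_poly k + Polynomial.smult (1/2) ([:0, 1:] - (sqrt_poly k)\<^sup>2)"

lemma sqrt_poly_0: "poly (sqrt_poly k) 0 = 0"
  by (induction k) auto

text \<open>
  One step multiplies the error \<open>r - p\<close>, where \<open>r = sqrt y\<close>, by \<open>1 - (r + p) / 2\<close>, a number between
  0 and \<open>1 - r / 2\<close>.
\<close>

lemma sqrt_poly_bounds:
  assumes "0 \<le> y" "y \<le> 1"
  shows "0 \<le> poly (sqrt_poly k) y \<and> poly (sqrt_poly k) y \<le> sqrt y \<and>
         sqrt y - poly (sqrt_poly k) y \<le> sqrt y * (1 - sqrt y / 2) ^ k"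
proof (induction k)
  case 0
  thus ?case using assms by simp
next
  case (Suc k)
  define r p where "r = sqrt y" and "p = poly (sqrt_poly k) y"
  have r: "0 \<le> r" "r \<le> 1" "r\<^sup>2 = y" unfolding r_def using assms by auto
  have p: "0 \<le> p" "p \<le> r" "r - p \<le> r * (1 - r / 2) ^ k" using Suc unfolding r_def p_def by auto
  have step: "poly (sqrt_poly (Suc k)) y = p + (r\<^sup>2 - p\<^sup>2) / 2"
    using r(3) by (simp add: p_def)
  have err: "r - poly (sqrt_poly (Suc k)) y = (r - p) * (1 - (r + p) / 2)"
    unfolding step by (simp add: power2_eq_square algebra_simps)
  have "(r - p) * (1 - (r + p) / 2) \<le> (r * (1 - r / 2) ^ k) * (1 - r / 2)"
    using p r by (intro mult_mono) auto
  moreover have "(r - p) * (1 - (r + p) / 2) \<ge> 0" using p r by (intro mult_nonneg_nonneg) auto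
  moreover have "p\<^sup>2 \<le> r\<^sup>2" using p r by (intro power_mono) auto
  ultimately show ?case
    using err p(1) unfolding r_def[symmetric] step by (auto simp: mult_ac)
qed

lemma sqrt_poly_tendsto:
  assumes "0 \<le> y" "y \<le> 1"
  shows "(\<lambda>k. poly (sqrt_poly k) y) \<longlonglongrightarrow> sqrt y"
proof -
  have "(\<lambda>k. sqrt y * (1 - sqrt y / 2) ^ k) \<longlonglongrightarrow> 0"
  proof (cases "y = 0")
    case False
    hence "sqrt y > 0" "sqrt y \<le> 1" using assms by auto
    hence "norm (1 - sqrt y / 2) < 1" unfolding real_norm_def by linarith
    from tendsto_mult_right_zero[OF LIMSEQ_power_zero[OF this]] show ?thesis .
  qed simp
  hence "(\<lambda>k. sqrt y - poly (sqrt_poly k) y) \<longlonglongrightarrow> 0"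
    by (rule tendsto_sandwich[OF _ _ tendsto_const, rotated 2])
       (use sqrt_poly_bounds[OF assms] in auto)
  from tendsto_diff[OF tendsto_const[of "sqrt y"] this] show ?thesis by simp
qed

lemma tendsto_sum_mset:
  fixes f :: "nat \<Rightarrow> 'a \<Rightarrow> real"
  assumes "\<And>x. x \<in># R \<Longrightarrow> (\<lambda>k. f k x) \<longlonglongrightarrow> g x"
  shows "(\<lambda>k. \<Sum>x\<in>#R. f k x) \<longlonglongrightarrow> (\<Sum>x\<in>#R. g x)"
  using assms by (induction R) (auto intro!: tendsto_add)

lemma sum_mset_nonneg:
  fixes R :: "real multiset"
  assumes "\<And>x. x \<in># R \<Longrightarrow> x \<ge> 0"
  shows "sum_mset R \<ge> 0"
  using assms by (induction R) auto

lemma member_le_sum_mset: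
  fixes R :: "real multiset"
  assumes "\<And>x. x \<in># R \<Longrightarrow> x \<ge> 0" "x \<in># R"
  shows "x \<le> sum_mset R"
proof -
  obtain S where S: "R = add_mset x S" using assms(2) by (metis mset_add)
  have "sum_mset S \<ge> 0" using assms(1) unfolding S by (intro sum_mset_nonneg) auto
  thus ?thesis by (simp add: S)
qed

text \<open>
  Division by the sum \<open>T\<close> moves all numbers into \<open>[0, 1]\<close>, where the polynomials converge. If \<open>T = 0\<close>,
  all numbers are 0, and both sides vanish under the convention \<open>x / 0 = 0\<close>.
\<close>

lemma sum_sqrt_tendsto:
  fixes R :: "real multiset"
  assumes nn: "\<And>x. x \<in># R \<Longrightarrow> x \<ge> 0"
  defines "T \<equiv> sum_mset R"
  shows "(\<lambda>k. sqrt T * (\<Sum>i\<le>degree (sqrt_poly k). coeff (sqrt_poly k) i * ((\<Sum>x\<in>#R. x ^ i) / T ^ i)))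
    \<longlonglongrightarrow> (\<Sum>x\<in>#R. sqrt x)"
proof -
  have T: "0 \<le> T" unfolding T_def using nn by (intro sum_mset_nonneg) auto
  have le: "x \<le> T" if "x \<in># R" for x unfolding T_def using member_le_sum_mset[OF nn] that by simp
  have eq: "(\<Sum>i\<le>degree p. coeff p i * ((\<Sum>x\<in>#R. x ^ i) / T ^ i)) = (\<Sum>x\<in>#R. poly p (x / T))" for p
    by (induction R) (auto simp: poly_altdef sum.distrib add_divide_distrib ring_distribs power_divide)
  have "(\<lambda>k. sqrt T * (\<Sum>x\<in>#R. poly (sqrt_poly k) (x / T))) \<longlonglongrightarrow> sqrt T * (\<Sum>x\<in>#R. sqrt (x / T))"
    using nn le T
    by (intro tendsto_mult tendsto_const tendsto_sum_mset sqrt_poly_tendsto) (auto simp: divide_le_eq_1)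
  also have "sqrt T * (\<Sum>x\<in>#R. sqrt (x / T)) = (\<Sum>x\<in>#R. sqrt T * sqrt (x / T))"
    by (simp add: sum_mset_distrib_left image_mset.compositionality comp_def)
  also have "\<dots> = (\<Sum>x\<in>#R. sqrt x)"
  proof (intro arg_cong[where f = sum_mset] image_mset_cong)
    fix x assume x: "x \<in># R"
    show "sqrt T * sqrt (x / T) = sqrt x"
      using nn[OF x] le[OF x] T by (cases "T = 0") (auto simp: real_sqrt_divide)
  qed
  finally show ?thesis unfolding eq .
qed

text \<open>
  The squared singular values. Taking real parts loses nothing by \<open>eigenvalue_gram_nonneg\<close>.
\<close>

definition gram_spectrum :: "complex mat \<Rightarrow> real multiset" where
  "gram_spectrum A = image_mset Re (proots (char_poly (mat_adjoint A * A)))"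

lemma trace_norm_conv: "trace_norm A = (\<Sum>x\<in>#gram_spectrum A. sqrt x)"
  unfolding trace_norm_def singular_values_def gram_spectrum_def by (simp add: image_mset.compositionality comp_def)

lemma gram_spectrum_nonneg: "A \<in> carrier_mat m n \<Longrightarrow> x \<in># gram_spectrum A \<Longrightarrow> x \<ge> 0"
  unfolding gram_spectrum_def using eigenvalue_gram_nonneg(1) by auto

lemma gram_spectrum_power_sum:
  assumes A: "A \<in> carrier_mat m n"
  shows "(\<Sum>x\<in>#gram_spectrum A. x ^ k) = Re (mtrace ((mat_adjoint A * A) ^\<^sub>m k))"
proof -
  have B: "mat_adjoint A * A \<in> carrier_mat n n" using A by simp
  have "(\<Sum>x\<in>#gram_spectrum A. x ^ k) = (\<Sum>e\<in>#proots (char_poly (mat_adjoint A * A)). Re e ^ k)"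
    by (simp add: gram_spectrum_def image_mset.compositionality comp_def)
  also have "\<dots> = (\<Sum>e\<in>#proots (char_poly (mat_adjoint A * A)). Re (e ^ k))"
    by (intro arg_cong[where f = sum_mset] image_mset_cong)
       (metis Re_complex_of_real eigenvalue_gram_nonneg(2)[OF A] of_real_power)
  also have "\<dots> = Re (\<Sum>e\<in>#proots (char_poly (mat_adjoint A * A)). e ^ k)"
  proof -
    have "(\<Sum>e\<in>#R. Re (e ^ k)) = Re (\<Sum>e\<in>#R. e ^ k)" for R by (induction R) auto
    thus ?thesis .
  qed
  finally show ?thesis by (simp add: sum_eigenvalues_power[OF B])
qed

lemma size_gram_spectrum:
  assumes A: "A \<in> carrier_mat m n" shows "size (gram_spectrum A) = n"
proof -
  have B: "mat_adjoint A * A \<in> carrier_mat n n" using A by simp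
  show ?thesis using degree_monic_char_poly[OF B]
    by (simp add: gram_spectrum_def size_proots_complex)
qed

text \<open>
  To be read with \<open>t i = tr ((A* A)^i)\<close>: the \<open>k\<close>-th polynomial approximation of \<open>tr sqrt (A* A)\<close>, after
  rescaling by \<open>t 1\<close>, which bounds all eigenvalues.
\<close>

definition trace_norm_approx :: "(nat \<Rightarrow> real) \<Rightarrow> nat \<Rightarrow> real" where
  "trace_norm_approx t k =
     sqrt (t 1) * (\<Sum>i\<le>degree (sqrt_poly k). coeff (sqrt_poly k) i * (t i / t 1 ^ i))"

lemma trace_norm_tendsto:
  assumes A: "A \<in> carrier_mat m n"
  shows "trace_norm_approx (\<lambda>i. Re (mtrace ((mat_adjoint A * A) ^\<^sub>m i))) \<longlonglongrightarrow> trace_norm A"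
proof -
  have "sum_mset (gram_spectrum A) = Re (mtrace ((mat_adjoint A * A) ^\<^sub>m 1))"
    using gram_spectrum_power_sum[OF A, of 1] by simp
  with sum_sqrt_tendsto[of "gram_spectrum A"] gram_spectrum_nonneg[OF A] show ?thesis
    unfolding trace_norm_conv trace_norm_approx_def by (simp add: gram_spectrum_power_sum[OF A])
qed

lemma mat_adjoint_adjoint [simp]: "mat_adjoint (mat_adjoint A) = (A :: complex mat)"
  by (intro eq_matI) auto

lemma pow_gram_shift:
  assumes A: "A \<in> carrier_mat m n" and B: "(B :: complex mat) \<in> carrier_mat n m"
  shows "(B * A) ^\<^sub>m Suc k = B * ((A * B) ^\<^sub>m k * A)"
proof (induction k)
  case 0
  show ?case using A B by auto
next
  case (Suc k)
  have c: "(A * B) ^\<^sub>m k \<in> carrier_mat m m" using A B by simp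
  have "(B * A) ^\<^sub>m Suc (Suc k) = B * ((A * B) ^\<^sub>m k * A) * (B * A)"
    using Suc by (metis pow_mat.simps(2))
  also have "\<dots> = B * (((A * B) ^\<^sub>m k * A) * (B * A))"
    by (rule assoc_mult_mat[of _ n m _ n _ n]) (use A B c in auto)
  also have "((A * B) ^\<^sub>m k * A) * (B * A) = (A * B) ^\<^sub>m k * (A * (B * A))"
    by (rule assoc_mult_mat[of _ m m _ n _ n]) (use A B c in auto)
  also have "A * (B * A) = (A * B) * A"
    by (rule assoc_mult_mat[of _ m n _ m _ n, symmetric]) (use A B c in auto)
  also have "(A * B) ^\<^sub>m k * ((A * B) * A) = (A * B) ^\<^sub>m Suc k * A"
    using A B c by (simp add: assoc_mult_mat[of _ m m _ m _ n])
  finally show ?case .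
qed

lemma trace_pow_swap:
  assumes A: "A \<in> carrier_mat m n" and B: "B \<in> carrier_mat n m"
  shows "mtrace ((B * A) ^\<^sub>m Suc k) = mtrace ((A * B) ^\<^sub>m Suc k)"
proof -
  have c: "(A * B) ^\<^sub>m k \<in> carrier_mat m m" using A B by simp
  have "mtrace ((B * A) ^\<^sub>m Suc k) = mtrace (((A * B) ^\<^sub>m k * A) * B)"
    unfolding pow_gram_shift[OF A B] by (rule mtrace_comm[of _ n m]) (use A B c in auto)
  also have "((A * B) ^\<^sub>m k * A) * B = (A * B) ^\<^sub>m Suc k"
    using assoc_mult_mat[OF c A B] by simp
  finally show ?thesis .
qed

lemma trace_norm_approx_cong:
  assumes "\<And>i. i > 0 \<Longrightarrow> t i = t' i"
  shows "trace_norm_approx t k = trace_norm_approx t' k"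
proof -
  have "coeff (sqrt_poly k) 0 = 0" using sqrt_poly_0[of k] by (simp add: poly_0_coeff_0)
  hence c: "coeff (sqrt_poly k) i * (t i / t 1 ^ i) = coeff (sqrt_poly k) i * (t' i / t' 1 ^ i)" for i
    using assms[of i] assms[of 1] by (cases "i = 0") auto
  show ?thesis unfolding trace_norm_approx_def c using assms[of 1] by simp
qed

text \<open>
  The traces of \<open>(A* A)^i\<close> and \<open>(A A*)^i\<close> agree for \<open>i > 0\<close>. The case \<open>i = 0\<close>, where they are the two
  different dimensions, does not enter the approximations.
\<close>

lemma trace_norm_adjoint:
  assumes A: "A \<in> carrier_mat m n"
  shows "trace_norm (mat_adjoint A) = trace_norm A"
proof -
  have Ad: "mat_adjoint A \<in> carrier_mat n m" using A by simp
  have t: "mtrace ((mat_adjoint A * A) ^\<^sub>m i) = mtrace ((A * mat_adjoint A) ^\<^sub>m i)" if "i > 0" for i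
    using trace_pow_swap[OF A Ad, of "i - 1"] that by simp
  have "trace_norm_approx (\<lambda>i. Re (mtrace ((mat_adjoint A * A) ^\<^sub>m i))) =
        trace_norm_approx (\<lambda>i. Re (mtrace ((A * mat_adjoint A) ^\<^sub>m i)))"
    by (rule ext, rule trace_norm_approx_cong) (simp add: t)
  thus ?thesis
    using trace_norm_tendsto[OF A] trace_norm_tendsto[OF Ad] by (simp add: LIMSEQ_unique)
qed

text \<open>
  In terms of \<open>y = sqrt (x / t)\<close> this says \<open>y (y - 1)^2 (y + 2) \<ge> 0\<close>. Equality holds at \<open>x = 0\<close> and to second
  order at \<open>x = t\<close>.
\<close>

lemma sqrt_ge_quadratic:
  assumes "x \<ge> 0" "t > 0"
  shows "sqrt x \<ge> 3 / (2 * sqrt t) * x - 1 / (2 * t * sqrt t) * x\<^sup>2"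
proof -
  define y where "y = sqrt (x / t)"
  have y: "y \<ge> 0" "x = t * y\<^sup>2" using assms by (auto simp: y_def)
  have st: "sqrt t > 0" "t = sqrt t * sqrt t" using assms by auto
  have sx: "sqrt x = sqrt t * y" using y by (simp add: real_sqrt_mult)
  have "0 \<le> y * ((y - 1)\<^sup>2 * (y + 2))" using y by auto
  hence "y - 3 / 2 * y\<^sup>2 + y ^ 4 / 2 \<ge> 0" by (simp add: power2_eq_square power4_eq_xxxx algebra_simps)
  hence "sqrt t * (y - 3 / 2 * y\<^sup>2 + y ^ 4 / 2) \<ge> 0" using st by simp
  also have "sqrt t * (y - 3 / 2 * y\<^sup>2 + y ^ 4 / 2) =
     sqrt x - (3 / (2 * sqrt t) * x - 1 / (2 * t * sqrt t) * x\<^sup>2)"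
  proof -
    have 1: "3 / (2 * sqrt t) * (t * y\<^sup>2) = sqrt t * (3 / 2 * y\<^sup>2)"
      using st by (simp add: field_simps)
    have 2: "1 / (2 * t * sqrt t) * (t * y\<^sup>2)\<^sup>2 = sqrt t * (y ^ 4 / 2)"
    proof -
      have "1 / (2 * t * sqrt t) * (t * y\<^sup>2)\<^sup>2 = t / sqrt t * (y ^ 4 / 2)"
        using assms by (simp add: field_simps power2_eq_square power4_eq_xxxx)
      also have "t / sqrt t = sqrt t" using assms by (simp add: real_div_sqrt)
      finally show ?thesis .
    qed
    show ?thesis unfolding sx unfolding y(2) 1 2 by (simp add: algebra_simps)
  qed
  finally show ?thesis by linarith
qed

lemma trace_norm_lower:
  assumes A: "A \<in> carrier_mat m n" and t: "t > 0"
  defines "H \<equiv> A * mat_adjoint A"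
  shows "trace_norm A \<ge> 3 / (2 * sqrt t) * Re (mtrace H) - 1 / (2 * t * sqrt t) * Re (mtrace (H * H))"
proof -
  have Ad: "mat_adjoint A \<in> carrier_mat n m" using A by simp
  have H: "H \<in> carrier_mat m m" using A unfolding H_def by simp
  have S: "(\<Sum>x\<in>#gram_spectrum (mat_adjoint A). x ^ k) = Re (mtrace (H ^\<^sub>m k))" for k
    using gram_spectrum_power_sum[OF Ad, of k] by (simp add: H_def)
  have H2: "H ^\<^sub>m 2 = H * H" using H by (simp add: numeral_2_eq_2)
  have "(\<Sum>x\<in>#gram_spectrum (mat_adjoint A). 3 / (2 * sqrt t) * x - 1 / (2 * t * sqrt t) * x\<^sup>2)
      \<le> (\<Sum>x\<in>#gram_spectrum (mat_adjoint A). sqrt x)"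
    by (intro sum_mset_mono sqrt_ge_quadratic t gram_spectrum_nonneg[OF Ad])
  also have "(\<Sum>x\<in>#gram_spectrum (mat_adjoint A). 3 / (2 * sqrt t) * x - 1 / (2 * t * sqrt t) * x\<^sup>2)
     = 3 / (2 * sqrt t) * (\<Sum>x\<in>#gram_spectrum (mat_adjoint A). x ^ 1)
       - 1 / (2 * t * sqrt t) * (\<Sum>x\<in>#gram_spectrum (mat_adjoint A). x\<^sup>2)"
  proof -
    have "(\<Sum>x\<in>#R. a * x - b * x\<^sup>2) = a * (\<Sum>x\<in>#R. x ^ 1) - b * (\<Sum>x\<in>#R. x\<^sup>2)"
      for R and a b :: real by (induction R) (auto simp: ring_distribs)
    thus ?thesis .
  qed
  finally show ?thesis
    using H unfolding S trace_norm_conv[symmetric] trace_norm_adjoint[OF A] H2 by simp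
qed

text \<open>
  Cauchy-Schwarz for the \<open>m\<close> eigenvalues of \<open>A A*\<close>. It matters that these are counted, and not the \<open>n\<close>
  eigenvalues of \<open>A* A\<close>, since \<open>n\<close> will be much larger than \<open>m\<close>.
\<close>

lemma trace_norm_upper:
  assumes A: "A \<in> carrier_mat m n"
  shows "trace_norm A \<le> sqrt (m * Re (mtrace (A * mat_adjoint A)))"
proof -
  have Ad: "mat_adjoint A \<in> carrier_mat n m" using A by simp
  have cs: "(\<Sum>x\<in>#R. sqrt x) \<le> sqrt (size R * sum_mset R)" if "\<And>x. x \<in># R \<Longrightarrow> x \<ge> 0" for R :: "real multiset"
  proof -
    obtain xs where xs: "mset xs = R" by (metis ex_mset)
    have nn: "xs ! i \<ge> 0" if "i < length xs" for i using that \<open>\<And>x. x \<in># R \<Longrightarrow> x \<ge> 0\<close> xs by auto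
    have "(\<Sum>x\<in>#R. sqrt x) = (\<Sum>i<length xs. 1 * sqrt (xs ! i))"
      unfolding xs[symmetric] by (metis (no_types, lifting) atLeast0LessThan length_map lambda_one mset_map nth_map sum.cong sum_list_sum_nth sum_mset_sum_list lessThan_iff mult_1)
    also have "\<dots> \<le> sqrt (\<Sum>i<length xs. 1\<^sup>2) * sqrt (\<Sum>i<length xs. (sqrt (xs ! i))\<^sup>2)"
      using L2_set_mult_ineq[of "\<lambda>_. 1" "\<lambda>i. sqrt (xs ! i)" "{..<length xs}"] unfolding L2_set_def
      using nn by (simp add: sum_nonneg)
    also have "(\<Sum>i<length xs. (sqrt (xs ! i))\<^sup>2) = (\<Sum>i<length xs. xs ! i)"
      using nn by (intro sum.cong) auto
    also have "\<dots> = sum_mset R" unfolding xs[symmetric] by (simp add: sum_list_sum_nth atLeast0LessThan sum_mset_sum_list)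
    finally show ?thesis unfolding xs[symmetric] real_sqrt_mult by simp
  qed
  have H: "A * mat_adjoint A \<in> carrier_mat m m" using A by simp
  have sm: "sum_mset (gram_spectrum (mat_adjoint A)) = Re (mtrace (A * mat_adjoint A))"
    using gram_spectrum_power_sum[OF Ad, of 1] H by simp
  have "(\<Sum>x\<in>#gram_spectrum (mat_adjoint A). sqrt x)
      \<le> sqrt (size (gram_spectrum (mat_adjoint A)) * sum_mset (gram_spectrum (mat_adjoint A)))"
    by (rule cs) (rule gram_spectrum_nonneg[OF Ad])
  thus ?thesis
    unfolding sm size_gram_spectrum[OF Ad] trace_norm_conv[symmetric] trace_norm_adjoint[OF A] .
qed

section \<open>Gaussian integrals over complex coordinates\<close>

text \<open>
  Completing the square turns the integrand into a multiple of a normal density.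
\<close>

lemma nn_integral_real_gaussian:
  fixes a b :: real
  assumes a: "a > 0"
  shows "(\<integral>\<^sup>+x. ennreal (exp (- a * x\<^sup>2 + b * x)) \<partial>lborel) = ennreal (sqrt (pi / a) * exp (b\<^sup>2 / (4 * a)))"
proof -
  define m s C where "m = b / (2 * a)" and "s = 1 / sqrt (2 * a)" and "C = sqrt (pi / a) * exp (b\<^sup>2 / (4 * a))"
  have s: "s > 0" "s\<^sup>2 = 1 / (2 * a)" using a by (auto simp: s_def power_divide)
  have C: "C \<ge> 0" using a by (simp add: C_def)
  have "exp (- a * x\<^sup>2 + b * x) = C * normal_density m s x" for x
  proof -
    have "- (x - m)\<^sup>2 / (2 * s\<^sup>2) = - a * x\<^sup>2 + b * x - b\<^sup>2 / (4 * a)"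
      unfolding s(2) m_def using a by (simp add: power2_eq_square field_simps)
    moreover have "sqrt (2 * pi * s\<^sup>2) = sqrt (pi / a)" unfolding s(2) by simp
    ultimately show ?thesis
      unfolding normal_density_def C_def using a by (simp add: exp_diff)
  qed
  hence "(\<integral>\<^sup>+x. ennreal (exp (- a * x\<^sup>2 + b * x)) \<partial>lborel)
      = (\<integral>\<^sup>+x. ennreal C * ennreal (normal_density m s x) \<partial>lborel)"
    using C s(1) by (simp add: ennreal_mult)
  also have "\<dots> = ennreal C * (\<integral>\<^sup>+x. ennreal (normal_density m s x) \<partial>lborel)"
    by (rule nn_integral_cmult) simp
  also have "(\<integral>\<^sup>+x. ennreal (normal_density m s x) \<partial>lborel) = 1"
    using s(1) by (subst nn_integral_eq_integral) (auto intro: integrable_normal_density)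
  finally show ?thesis by (simp add: C_def)
qed

lemma measurable_Complex [measurable]:
  "(\<lambda>(x, y). Complex x y) \<in> borel_measurable (lborel \<Otimes>\<^sub>M lborel)"
  by (subst borel_measurable_complex_iff) (auto simp: case_prod_beta)

lemma lborel_complex: "(lborel :: complex measure) = distr (lborel \<Otimes>\<^sub>M lborel) borel (\<lambda>(x, y). Complex x y)"
proof (rule lborel_eqI)
  fix l u :: complex assume le: "\<And>b. b \<in> Basis \<Longrightarrow> l \<bullet> b \<le> u \<bullet> b"
  have vim: "(\<lambda>(x, y). Complex x y) -` box l u \<inter> space (lborel \<Otimes>\<^sub>M lborel) = {Re l<..<Re u} \<times> {Im l<..<Im u}"
    by (auto simp: box_def Basis_complex_def space_pair_measure)
  have "emeasure (distr (lborel \<Otimes>\<^sub>M lborel) borel (\<lambda>(x, y). Complex x y)) (box l u)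
      = emeasure (lborel \<Otimes>\<^sub>M lborel) ({Re l<..<Re u} \<times> {Im l<..<Im u})"
    by (subst emeasure_distr) (auto simp: vim)
  also have "\<dots> = ennreal (\<Prod>b\<in>Basis. (u - l) \<bullet> b)"
    using le[of 1] le[of \<i>]
    by (subst lborel.emeasure_pair_measure_Times)
       (auto simp: Basis_complex_def ennreal_mult)
  finally show "emeasure (distr (lborel \<Otimes>\<^sub>M lborel) borel (\<lambda>(x, y). Complex x y)) (box l u) = ennreal (\<Prod>b\<in>Basis. (u - l) \<bullet> b)" .
qed simp

lemma nn_integral_complex_gaussian:
  fixes a :: real and b :: complex
  assumes a: "a > 0"
  shows "(\<integral>\<^sup>+z. ennreal (exp (- a * (cmod z)\<^sup>2 + Re (z * cnj b))) \<partial>lborel) = ennreal (pi / a * exp ((cmod b)\<^sup>2 / (4 * a)))"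
proof -
  let ?f = "\<lambda>c x. ennreal (exp (- a * x\<^sup>2 + c * x))"
  have "(\<integral>\<^sup>+z. ennreal (exp (- a * (cmod z)\<^sup>2 + Re (z * cnj b))) \<partial>lborel)
      = (\<integral>\<^sup>+(x, y). ?f (Re b) x * ?f (Im b) y \<partial>(lborel \<Otimes>\<^sub>M lborel))"
    by (subst lborel_complex, subst nn_integral_distr)
       (auto simp: case_prod_beta cmod_power2 ennreal_mult[symmetric] exp_add[symmetric] algebra_simps intro!: nn_integral_cong)
  also have "\<dots> = (\<integral>\<^sup>+x. \<integral>\<^sup>+y. ?f (Re b) x * ?f (Im b) y \<partial>lborel \<partial>lborel)"
    by (subst lborel.nn_integral_fst[symmetric]) auto
  also have "\<dots> = (\<integral>\<^sup>+x. ?f (Re b) x \<partial>lborel) * (\<integral>\<^sup>+y. ?f (Im b) y \<partial>lborel)"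
    by (simp add: nn_integral_cmult nn_integral_multc)
  also have "\<dots> = ennreal ((sqrt (pi / a) * sqrt (pi / a)) * (exp ((Re b)\<^sup>2 / (4 * a)) * exp ((Im b)\<^sup>2 / (4 * a))))"
    unfolding nn_integral_real_gaussian[OF a]
    by (subst ennreal_mult[symmetric]) (use a in \<open>auto simp only: mult_ac\<close>, auto)
  also have "sqrt (pi / a) * sqrt (pi / a) = pi / a" using a by simp
  also have "exp ((Re b)\<^sup>2 / (4 * a)) * exp ((Im b)\<^sup>2 / (4 * a)) = exp ((cmod b)\<^sup>2 / (4 * a))"
    by (simp add: exp_add[symmetric] cmod_power2 add_divide_distrib)
  finally show ?thesis .
qed

text \<open>
  The normalisation makes \<open>|z|^2\<close> exponentially distributed with mean 1; this is why the diagonal of the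
  Gram matrix of rows of length \<open>d\<close> will be centred at \<open>d\<close>.
\<close>

definition std_gaussian :: "complex measure" where
  "std_gaussian = density lborel (\<lambda>z. ennreal (exp (- (cmod z)\<^sup>2) / pi))"

lemma sets_std_gaussian [measurable_cong, simp]: "sets std_gaussian = sets borel"
  by (simp add: std_gaussian_def)

lemma space_std_gaussian [simp]: "space std_gaussian = UNIV"
  by (simp add: std_gaussian_def)

text \<open>
  The joint exponential moments of \<open>|z|^2\<close> and of the real-linear functionals of \<open>z\<close>.
\<close>

lemma nn_integral_std_gaussian:
  assumes l: "l < 1"
  shows "(\<integral>\<^sup>+z. ennreal (exp (l * (cmod z)\<^sup>2 + Re (z * cnj b))) \<partial>std_gaussian) = ennreal (1 / (1 - l) * exp ((cmod b)\<^sup>2 / (4 * (1 - l))))"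
proof -
  have "(\<integral>\<^sup>+z. ennreal (exp (l * (cmod z)\<^sup>2 + Re (z * cnj b))) \<partial>std_gaussian)
     = (\<integral>\<^sup>+z. ennreal (1 / pi) * ennreal (exp (- (1 - l) * (cmod z)\<^sup>2 + Re (z * cnj b))) \<partial>lborel)"
    unfolding std_gaussian_def
    by (subst nn_integral_density)
       (auto intro!: nn_integral_cong simp: ennreal_mult[symmetric] exp_add[symmetric] algebra_simps)
  also have "\<dots> = ennreal (1 / pi) * ennreal (pi / (1 - l) * exp ((cmod b)\<^sup>2 / (4 * (1 - l))))"
    using l by (subst nn_integral_cmult, measurable)
      (simp only: nn_integral_complex_gaussian diff_gt_0_iff_gt)
  also have "\<dots> = ennreal (1 / (1 - l) * exp ((cmod b)\<^sup>2 / (4 * (1 - l))))"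
    using l by (simp add: ennreal_mult[symmetric])
  finally show ?thesis .
qed

interpretation std_gaussian: prob_space std_gaussian
proof
  show "emeasure std_gaussian (space std_gaussian) = 1"
    using nn_integral_std_gaussian[of 0 0] by simp
qed

interpretation gauss: product_sigma_finite "\<lambda>_::nat. std_gaussian"
  by standard

interpretation leb: product_sigma_finite "\<lambda>_::nat. lborel :: complex measure"
  by standard

abbreviation gauss_vec :: "nat set \<Rightarrow> (nat \<Rightarrow> complex) measure" where
  "gauss_vec I \<equiv> Pi\<^sub>M I (\<lambda>_. std_gaussian)"

abbreviation leb_vec :: "nat set \<Rightarrow> (nat \<Rightarrow> complex) measure" where
  "leb_vec I \<equiv> Pi\<^sub>M I (\<lambda>_. lborel)"

lemma sets_gauss_vec: "sets (gauss_vec I) = sets (leb_vec I)"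
  by (rule sets_PiM_cong) auto

lemma emeasure_gauss_vec_space: "emeasure (gauss_vec I) (space (gauss_vec I)) = 1"
  using prob_space_PiM[of I "\<lambda>_. std_gaussian"] std_gaussian.prob_space_axioms
  by (auto simp: prob_space.emeasure_space_1)

lemma gauss_vec_density:
  assumes I: "finite I"
  shows "gauss_vec I = density (leb_vec I) (\<lambda>x. \<Prod>i\<in>I. ennreal (exp (- (cmod (x i))\<^sup>2) / pi))"
proof (rule gauss.PiM_eqI[OF I, symmetric])
  show "sets (density (leb_vec I) (\<lambda>x. \<Prod>i\<in>I. ennreal (exp (- (cmod (x i))\<^sup>2) / pi))) = sets (gauss_vec I)"
    by (simp add: sets_gauss_vec)
  fix A :: "nat \<Rightarrow> complex set" assume A: "\<And>i. i \<in> I \<Longrightarrow> A i \<in> sets std_gaussian"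
  hence A': "\<And>i. i \<in> I \<Longrightarrow> A i \<in> sets lborel" by simp
  have "emeasure (density (leb_vec I) (\<lambda>x. \<Prod>i\<in>I. ennreal (exp (- (cmod (x i))\<^sup>2) / pi))) (Pi\<^sub>E I A)
     = (\<integral>\<^sup>+x. (\<Prod>i\<in>I. ennreal (exp (- (cmod (x i))\<^sup>2) / pi)) * indicator (Pi\<^sub>E I A) x \<partial>leb_vec I)"
    using A' I by (subst emeasure_density) (auto intro!: sets_PiM_I_finite)
  also have "\<dots> = (\<integral>\<^sup>+x. (\<Prod>i\<in>I. ennreal (exp (- (cmod (x i))\<^sup>2) / pi) * indicator (A i) (x i)) \<partial>leb_vec I)"
    using I by (intro nn_integral_cong) (auto simp: prod.distrib indicator_def space_PiM PiE_iff split: if_splits)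
  also have "\<dots> = (\<Prod>i\<in>I. \<integral>\<^sup>+z. ennreal (exp (- (cmod z)\<^sup>2) / pi) * indicator (A i) z \<partial>lborel)"
    using A' by (intro leb.product_nn_integral_prod I) auto
  also have "\<dots> = (\<Prod>i\<in>I. emeasure std_gaussian (A i))"
    using A' by (intro prod.cong) (auto simp: std_gaussian_def emeasure_density)
  finally show "emeasure (density (leb_vec I) (\<lambda>x. \<Prod>i\<in>I. ennreal (exp (- (cmod (x i))\<^sup>2) / pi))) (Pi\<^sub>E I A)
     = (\<Prod>i\<in>I. emeasure std_gaussian (A i))" .
qed

section \<open>Cones, the ball and the Gaussian measure\<close>

lemma emeasure_lborel_scale:
  fixes A :: "complex set"
  assumes c: "c > 0" and A: "A \<in> sets borel"
  shows "emeasure lborel A = ennreal (c\<^sup>2) * emeasure lborel ((\<lambda>z. c *\<^sub>R z) -` A)"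
proof -
  have "lborel = density (distr lborel borel (\<lambda>z::complex. 0 + c *\<^sub>R z)) (\<lambda>_. ennreal (\<bar>c\<bar> ^ DIM(complex)))"
    using c by (intro lborel_affine) auto
  hence "emeasure lborel A = emeasure (density (distr lborel borel (\<lambda>z::complex. c *\<^sub>R z)) (\<lambda>_. ennreal (c\<^sup>2))) A"
    using c by (simp add: DIM_complex)
  also have "\<dots> = ennreal (c\<^sup>2) * emeasure lborel ((\<lambda>z. c *\<^sub>R z) -` A)"
    using A by (subst emeasure_density) (auto simp: nn_integral_cmult_indicator emeasure_distr)
  finally show ?thesis .
qed

lemma emeasure_leb_vec_scale:
  assumes I: "finite I" and c: "c > 0" and A: "A \<in> sets (leb_vec I)"
  shows "emeasure (leb_vec I) A =
    ennreal (c ^ (2 * card I)) * emeasure (leb_vec I) ((\<lambda>x. \<lambda>i\<in>I. c *\<^sub>R x i) -` A \<inter> space (leb_vec I))"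
proof -
  let ?S = "\<lambda>x. \<lambda>i\<in>I. c *\<^sub>R x i :: complex"
  have S [measurable]: "?S \<in> measurable (leb_vec I) (leb_vec I)"
    by measurable
  have "scale_measure (ennreal (c ^ (2 * card I))) (distr (leb_vec I) (leb_vec I) ?S) = leb_vec I"
  proof (rule leb.PiM_eqI[OF I])
    fix A :: "nat \<Rightarrow> complex set" assume A: "\<And>i. i \<in> I \<Longrightarrow> A i \<in> sets lborel"
    have pre: "?S -` Pi\<^sub>E I A \<inter> space (leb_vec I) = Pi\<^sub>E I (\<lambda>i. (\<lambda>z. c *\<^sub>R z) -` A i)"
      by (auto simp: space_PiM PiE_iff)
    have A2: "(\<lambda>z. c *\<^sub>R z) -` A i \<in> sets lborel" if "i \<in> I" for i
    proof -
      have "(\<lambda>z. c *\<^sub>R z) \<in> borel_measurable (borel :: complex measure)" by measurable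
      from measurable_sets[OF this, of "A i"] show ?thesis using A[OF that] by simp
    qed
    have "emeasure (distr (leb_vec I) (leb_vec I) ?S) (Pi\<^sub>E I A)
        = emeasure (leb_vec I) (Pi\<^sub>E I (\<lambda>i. (\<lambda>z. c *\<^sub>R z) -` A i))"
      using A I by (subst emeasure_distr[OF S]) (auto simp: pre intro!: sets_PiM_I_finite)
    also have "\<dots> = (\<Prod>i\<in>I. emeasure lborel ((\<lambda>z. c *\<^sub>R z) -` A i))"
      using A2 I by (intro leb.emeasure_PiM) auto
    finally show "emeasure (scale_measure (ennreal (c ^ (2 * card I))) (distr (leb_vec I) (leb_vec I) ?S)) (Pi\<^sub>E I A)
       = (\<Prod>i\<in>I. emeasure lborel (A i))"
      using A c by (simp add: emeasure_lborel_scale[OF c] prod.distrib power_mult ennreal_power)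
  qed (simp add: sets_scale_measure)
  hence "emeasure (leb_vec I) A
       = emeasure (scale_measure (ennreal (c ^ (2 * card I))) (distr (leb_vec I) (leb_vec I) ?S)) A" by simp
  also have "\<dots> = ennreal (c ^ (2 * card I)) * emeasure (leb_vec I) (?S -` A \<inter> space (leb_vec I))"
    using A by (simp add: emeasure_distr[OF S])
  finally show ?thesis .
qed

definition sq_norm :: "nat set \<Rightarrow> (nat \<Rightarrow> complex) \<Rightarrow> real" where
  "sq_norm I x = (\<Sum>i\<in>I. (cmod (x i))\<^sup>2)"

lemma sq_norm_nonneg: "sq_norm I x \<ge> 0"
  unfolding sq_norm_def by (intro sum_nonneg) auto

lemma sq_norm_measurable [measurable]: "sq_norm I \<in> borel_measurable (leb_vec I)"
  unfolding sq_norm_def by measurable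

lemma exp_layer_cake:
  assumes "q \<ge> 0"
  shows "(\<integral>\<^sup>+u. ennreal (exp (- u)) * indicator {q..} u \<partial>lborel) = ennreal (exp (- q))"
proof -
  have "((\<lambda>u::real. - exp (- u)) \<longlongrightarrow> 0) at_top"
    by real_asymp
  moreover have "((\<lambda>u::real. - exp (- u)) has_real_derivative exp (- u)) (at u)" for u
    by (auto intro!: derivative_eq_intros)
  ultimately show ?thesis
    using nn_integral_FTC_atLeast[of "\<lambda>u. exp (- u)" q "\<lambda>u. - exp (- u)" 0] by simp
qed

text \<open>
  Layer cake: \<open>exp (- |x|^2)\<close> is the integral of \<open>exp (- u)\<close> over all \<open>u \<ge> |x|^2\<close>. After exchanging the
  integrals, the inner one is the volume of \<open>E\<close> intersected with the ball of radius \<open>sqrt u\<close>. As \<open>E\<close> is a cone,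
  this is \<open>u^n\<close> times the volume of the part of \<open>E\<close> in the unit ball, and the integral of \<open>u^n exp (- u)\<close> is \<open>n!\<close>.
\<close>

lemma emeasure_cone_inter_ball:
  assumes I: "finite I" and E: "E \<in> sets (leb_vec I)"
    and cone: "\<And>x c. x \<in> space (leb_vec I) \<Longrightarrow> c > 0 \<Longrightarrow> (\<lambda>i\<in>I. c *\<^sub>R x i) \<in> E \<longleftrightarrow> x \<in> E"
  shows "ennreal (pi ^ card I) * emeasure (gauss_vec I) E =
    ennreal (fact (card I)) * emeasure (leb_vec I) (E \<inter> {x \<in> space (leb_vec I). sq_norm I x \<le> 1})"
proof -
  let ?L = "leb_vec I" and ?n = "card I"
  note [measurable] = E
  interpret L: finite_product_sigma_finite "\<lambda>_. lborel" I by standard (rule I)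
  interpret P: pair_sigma_finite ?L lborel by standard
  let ?B = "\<lambda>u. E \<inter> {x \<in> space ?L. sq_norm I x \<le> u}"
  have Bm [measurable]: "?B u \<in> sets ?L" for u by measurable
  have "ennreal (pi ^ ?n) * emeasure (gauss_vec I) E
      = ennreal (pi ^ ?n) * (\<integral>\<^sup>+x. (\<Prod>i\<in>I. ennreal (exp (- (cmod (x i))\<^sup>2) / pi)) * indicator E x \<partial>?L)"
    by (subst gauss_vec_density[OF I], subst emeasure_density) auto
  also have "\<dots> = (\<integral>\<^sup>+x. ennreal (pi ^ ?n) * ((\<Prod>i\<in>I. ennreal (exp (- (cmod (x i))\<^sup>2) / pi)) * indicator E x) \<partial>?L)"
    by (rule nn_integral_cmult[symmetric]) measurable
  also have "\<dots> = (\<integral>\<^sup>+x. ennreal (exp (- sq_norm I x)) * indicator E x \<partial>?L)"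
  proof (rule nn_integral_cong)
    fix x
    have "(\<Prod>i\<in>I. ennreal (exp (- (cmod (x i))\<^sup>2) / pi)) = ennreal (exp (- sq_norm I x) / pi ^ ?n)"
      using I by (subst prod_ennreal) (auto simp: prod_dividef sq_norm_def exp_sum sum_negf[symmetric])
    moreover have "ennreal (pi ^ ?n) * ennreal (exp (- sq_norm I x) / pi ^ ?n) = ennreal (exp (- sq_norm I x))"
      by (subst ennreal_mult[symmetric]) auto
    ultimately show "ennreal (pi ^ ?n) * ((\<Prod>i\<in>I. ennreal (exp (- (cmod (x i))\<^sup>2) / pi)) * indicator E x)
       = ennreal (exp (- sq_norm I x)) * indicator E x"
      by (simp add: mult.assoc[symmetric])
  qed
  also have "\<dots> = (\<integral>\<^sup>+x. (\<integral>\<^sup>+u. ennreal (exp (- u)) * indicator {sq_norm I x..} u * indicator E x \<partial>lborel) \<partial>?L)"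
    by (intro nn_integral_cong, subst nn_integral_multc) (auto simp: exp_layer_cake sq_norm_nonneg)
  also have "\<dots> = (\<integral>\<^sup>+u. (\<integral>\<^sup>+x. ennreal (exp (- u)) * indicator {sq_norm I x..} u * indicator E x \<partial>?L) \<partial>lborel)"
  proof (rule P.Fubini'[symmetric])
    have [measurable]: "{z \<in> space (?L \<Otimes>\<^sub>M lborel). sq_norm I (fst z) \<le> snd z} \<in> sets (?L \<Otimes>\<^sub>M lborel)"
      by measurable
    have "(\<lambda>z. ennreal (exp (- snd z)) * indicator {z \<in> space (?L \<Otimes>\<^sub>M lborel). sq_norm I (fst z) \<le> snd z} z * indicator E (fst z))
       \<in> borel_measurable (?L \<Otimes>\<^sub>M lborel)" by measurable
    thus "(\<lambda>(x, u). ennreal (exp (- u)) * indicator {sq_norm I x..} u * indicator E x) \<in> borel_measurable (?L \<Otimes>\<^sub>M lborel)"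
      by (rule measurable_cong[THEN iffD1, rotated]) (auto simp: indicator_def)
  qed
  also have "\<dots> = (\<integral>\<^sup>+u. ennreal (exp (- u)) * emeasure ?L (?B u) \<partial>lborel)"
  proof (rule nn_integral_cong)
    fix u :: real
    have "(\<integral>\<^sup>+x. ennreal (exp (- u)) * indicator {sq_norm I x..} u * indicator E x \<partial>?L)
        = (\<integral>\<^sup>+x. ennreal (exp (- u)) * indicator (?B u) x \<partial>?L)"
      by (intro nn_integral_cong) (auto simp: indicator_def)
    also have "\<dots> = ennreal (exp (- u)) * emeasure ?L (?B u)"
      by (rule nn_integral_cmult_indicator) (rule Bm)
    finally show "(\<integral>\<^sup>+x. ennreal (exp (- u)) * indicator {sq_norm I x..} u * indicator E x \<partial>?L)
       = ennreal (exp (- u)) * emeasure ?L (?B u)" .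
  qed
  also have "\<dots> = (\<integral>\<^sup>+u. ennreal (u ^ ?n * exp (- u)) * indicator {0..} u * emeasure ?L (?B 1) \<partial>lborel)"
  proof (rule nn_integral_cong_AE)
    \<comment> \<open>At \<open>u = 0\<close> the intersection of \<open>E\<close> with the ball is \<open>E \<inter> {0}\<close>; this single value of \<open>u\<close> is discarded.\<close>
    have "AE u in lborel. u \<noteq> (0::real)" by (rule AE_lborel_singleton)
    thus "AE u in lborel. ennreal (exp (- u)) * emeasure ?L (?B u)
        = ennreal (u ^ ?n * exp (- u)) * indicator {0..} u * emeasure ?L (?B 1)"
    proof eventually_elim
      case (elim u)
      show ?case
      proof (cases "u > 0")
        case True
        define c where "c = 1 / sqrt u"
        have c: "c > 0" "c\<^sup>2 = 1 / u" using True by (auto simp: c_def power_divide)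
        have sc: "sq_norm I (\<lambda>i\<in>I. c *\<^sub>R x i) = sq_norm I x / u" for x
          unfolding sq_norm_def using c True
          by (simp add: power_mult_distrib sum_divide_distrib)
        have pre: "(\<lambda>x. \<lambda>i\<in>I. c *\<^sub>R x i) -` ?B 1 \<inter> space ?L = ?B u"
          using cone[OF _ c(1)] True sets.sets_into_space[OF E]
          by (auto simp: sc space_PiM)
        have "emeasure ?L (?B 1) = ennreal (c ^ (2 * ?n)) * emeasure ?L (?B u)"
          using emeasure_leb_vec_scale[OF I c(1) Bm[of 1]] unfolding pre .
        hence "ennreal (u ^ ?n) * emeasure ?L (?B 1) = ennreal (u ^ ?n * c ^ (2 * ?n)) * emeasure ?L (?B u)"
          using True by (simp add: ennreal_mult mult.assoc)
        also have "u ^ ?n * c ^ (2 * ?n) = 1"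
          using True by (simp add: power_mult c(2) power_mult_distrib[symmetric])
        finally show ?thesis using True
          by (simp add: ennreal_mult mult_ac)
      next
        case False
        hence "?B u = {}" using elim sq_norm_nonneg[of I] by (auto simp: not_less) (meson order_trans order.antisym)
        thus ?thesis using False elim by simp
      qed
    qed
  qed
  also have "\<dots> = ennreal (fact ?n) * emeasure ?L (?B 1)"
    by (subst nn_integral_multc) (auto simp: nn_intergal_power_times_exp_Ici)
  finally show ?thesis .
qed

lemma unit_ball_conv: "unit_ball n = {x \<in> space (leb_vec {..<n}). sq_norm {..<n} x \<le> 1}"
  by (auto simp: unit_ball_def space_PiM L2_set_def sq_norm_def)

text \<open>
  The cone identity for the whole space, which has Gaussian measure 1.
\<close>

lemma emeasure_unit_ball: "emeasure (leb_vec {..<n}) (unit_ball n) = ennreal (pi ^ n / fact n)"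
proof -
  have sp: "space (gauss_vec {..<n}) = space (leb_vec {..<n})" by (simp add: space_PiM)
  have "ennreal (pi ^ n) * 1 = ennreal (fact n) * emeasure (leb_vec {..<n}) (unit_ball n)"
    using emeasure_cone_inter_ball[of "{..<n}" "space (leb_vec {..<n})"] emeasure_gauss_vec_space[of "{..<n}"]
    by (simp add: unit_ball_conv sp space_PiM Int_absorb1 Collect_conj_eq)
  hence "ennreal (1 / fact n) * ennreal (pi ^ n) = ennreal (1 / fact n) * ennreal (fact n) * emeasure (leb_vec {..<n}) (unit_ball n)"
    by (simp add: mult.assoc)
  also have "ennreal (1 / fact n) * ennreal (fact n) = 1"
    by (subst ennreal_mult[symmetric]) auto
  finally show ?thesis by (simp add: ennreal_mult[symmetric])
qed

text \<open>
  By \<open>emeasure_cone_inter_ball\<close>, the volume of the part of a cone in the ball is proportional to its Gaussian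
  measure, with a factor that does not depend on the cone.
\<close>

lemma emeasure_uniform_ball_cone:
  assumes E: "E \<in> sets (leb_vec {..<n})"
    and cone: "\<And>x c. x \<in> space (leb_vec {..<n}) \<Longrightarrow> c > 0 \<Longrightarrow> (\<lambda>i\<in>{..<n}. c *\<^sub>R x i) \<in> E \<longleftrightarrow> x \<in> E"
  shows "emeasure (uniform_measure (leb_vec {..<n}) (unit_ball n)) E = emeasure (gauss_vec {..<n}) E"
proof -
  let ?L = "leb_vec {..<n}" and ?g = "emeasure (gauss_vec {..<n}) E"
  have B: "unit_ball n \<in> sets ?L" unfolding unit_ball_conv by measurable
  have "ennreal (pi ^ n) * ?g = ennreal (fact n) * emeasure ?L (E \<inter> unit_ball n)"
    using emeasure_cone_inter_ball[OF _ E cone] by (simp add: unit_ball_conv)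
  hence "ennreal (1 / fact n) * ennreal (pi ^ n) * ?g
      = ennreal (1 / fact n) * ennreal (fact n) * emeasure ?L (E \<inter> unit_ball n)"
    by (simp add: mult.assoc)
  also have "ennreal (1 / fact n) * ennreal (fact n) = 1"
    by (subst ennreal_mult[symmetric]) auto
  finally have *: "emeasure ?L (unit_ball n \<inter> E) = ennreal (pi ^ n / fact n) * ?g"
    by (simp add: ennreal_mult[symmetric] Int_commute)
  have "emeasure (uniform_measure ?L (unit_ball n)) E = ennreal (pi ^ n / fact n) * ?g / ennreal (pi ^ n / fact n)"
    by (simp only: emeasure_uniform_measure[OF B E] emeasure_unit_ball *)
  also have "\<dots> = ?g * (ennreal (pi ^ n / fact n) / ennreal (pi ^ n / fact n))"
    by (simp only: ennreal_times_divide mult.commute)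
  also have "ennreal (pi ^ n / fact n) / ennreal (pi ^ n / fact n) = 1"
    by (intro ennreal_divide_self) (auto simp: ennreal_eq_0_iff not_le)
  finally show ?thesis by simp
qed

section \<open>Concentration of Gram matrices of Gaussian rows\<close>

lemma measurable_cnj: "f \<in> borel_measurable M \<Longrightarrow> (\<lambda>x. cnj (f x)) \<in> borel_measurable M"
  by (rule measurable_compose[of f M borel cnj]) (auto intro!: borel_measurable_continuous_onI continuous_intros)

text \<open>
  The inner product of two rows of length \<open>d\<close>, whose \<open>j\<close>-th coordinates are stored in \<open>x\<close> at the places
  \<open>u j\<close> and \<open>v j\<close>.
\<close>

definition cross :: "nat \<Rightarrow> (nat \<Rightarrow> nat) \<Rightarrow> (nat \<Rightarrow> nat) \<Rightarrow> (nat \<Rightarrow> complex) \<Rightarrow> complex" where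
  "cross d u v x = (\<Sum>j<d. x (u j) * cnj (x (v j)))"

lemma measurable_cross [measurable]:
  assumes "u ` {..<d} \<subseteq> I" "v ` {..<d} \<subseteq> I"
  shows "cross d u v \<in> borel_measurable (leb_vec I)"
proof -
  have "(\<lambda>x. x (u j)) \<in> borel_measurable (leb_vec I)" "(\<lambda>x. x (v j)) \<in> borel_measurable (leb_vec I)"
    if "j \<in> {..<d}" for j
    using measurable_component_singleton[of "u j" I "\<lambda>_. lborel"]
      measurable_component_singleton[of "v j" I "\<lambda>_. lborel"] that assms by auto
  note uv = this
  have "(\<lambda>x. cnj (x (v j))) \<in> borel_measurable (leb_vec I)" if "j \<in> {..<d}" for j
    using measurable_cnj[OF uv(2)[OF that]] .
  thus ?thesis unfolding cross_def[abs_def]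
    by (intro borel_measurable_sum borel_measurable_times uv(1))
qed

lemma nn_integral_gauss_vec_exp_sum_sq:
  assumes I: "finite I" and J: "J \<subseteq> I" and l: "l < 1"
  shows "(\<integral>\<^sup>+x. ennreal (exp (l * (\<Sum>i\<in>J. (cmod (x i))\<^sup>2))) \<partial>gauss_vec I) = ennreal ((1 / (1 - l)) ^ card J)"
proof -
  have fJ: "finite J" using I J finite_subset by blast
  have "(\<integral>\<^sup>+x. ennreal (exp (l * (\<Sum>i\<in>J. (cmod (x i))\<^sup>2))) \<partial>gauss_vec I)
      = (\<integral>\<^sup>+x. (\<Prod>i\<in>I. if i \<in> J then ennreal (exp (l * (cmod (x i))\<^sup>2)) else 1) \<partial>gauss_vec I)"
    using I J fJ
    by (intro nn_integral_cong)
       (simp add: prod.If_cases Int_absorb1 prod_ennreal exp_sum[symmetric] sum_distrib_left)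
  also have "\<dots> = (\<Prod>i\<in>I. \<integral>\<^sup>+z. (if i \<in> J then ennreal (exp (l * (cmod z)\<^sup>2)) else 1) \<partial>std_gaussian)"
    by (rule gauss.product_nn_integral_prod[OF I]) auto
  also have "\<dots> = (\<Prod>i\<in>I. if i \<in> J then ennreal (1 / (1 - l)) else 1)"
    using nn_integral_std_gaussian[OF l, of 0] std_gaussian.emeasure_space_1
    by (intro prod.cong) auto
  also have "\<dots> = ennreal ((1 / (1 - l)) ^ card J)"
    using I J l by (simp add: prod.If_cases Int_absorb1 ennreal_power)
  finally show ?thesis .
qed

lemma nn_integral_gauss_vec_exp_cross_same:
  assumes I: "finite I" and u: "u ` {..<d} \<subseteq> I" "inj_on u {..<d}" and l: "l < 1"
  shows "(\<integral>\<^sup>+x. ennreal (exp (l * Re (cross d u u x))) \<partial>gauss_vec I) = ennreal ((1 / (1 - l)) ^ d)"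
proof -
  have "Re (cross d u u x) = (\<Sum>i\<in>u ` {..<d}. (cmod (x i))\<^sup>2)" for x
  proof -
    have "Re (cross d u u x) = (\<Sum>j<d. (cmod (x (u j)))\<^sup>2)"
      unfolding cross_def Re_sum cmod_power2 by (intro sum.cong) (auto simp: power2_eq_square)
    thus ?thesis using u(2) by (simp add: sum.reindex)
  qed
  thus ?thesis
    using nn_integral_gauss_vec_exp_sum_sq[OF I u(1) l] u(2) by (simp add: card_image)
qed

text \<open>
  Integrate over the row \<open>u\<close> first. With the row \<open>v\<close> fixed, the exponent is real-linear in the row \<open>u\<close>, so the
  inner integral is \<open>exp (l^2 / 4 * |v|^2)\<close>; what remains is the exponential moment of a squared length.
\<close>

lemma nn_integral_gauss_vec_exp_cross_distinct:
  assumes I: "finite I" and u: "u ` {..<d} \<subseteq> I" "inj_on u {..<d}"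
    and v: "v ` {..<d} \<subseteq> I" "inj_on v {..<d}"
    and uv: "u ` {..<d} \<inter> v ` {..<d} = {}"
    and c: "cmod c = 1" and l: "l\<^sup>2 < 4"
  shows "(\<integral>\<^sup>+x. ennreal (exp (l * Re (c * cross d u v x))) \<partial>gauss_vec I)
    = ennreal ((1 / (1 - l\<^sup>2 / 4)) ^ d)"
proof -
  define J K where "J = u ` {..<d}" and "K = I - J"
  have IJK: "K \<union> J = I" "K \<inter> J = {}" "finite K" "finite J"
    using u I unfolding J_def K_def by auto
  have vK: "v ` {..<d} \<subseteq> K" using v uv unfolding K_def J_def by auto
  define w where "w = the_inv_into {..<d} u"
  have w: "w (u j) = j" if "j < d" for j
    unfolding w_def using u(2) that by (simp add: the_inv_into_f_f)
  define b where "b = (\<lambda>x n. of_real l * cnj c * x (v (w n)) :: complex)"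
  have meas: "(\<lambda>x. ennreal (exp (l * Re (c * cross d u v x)))) \<in> borel_measurable (gauss_vec (K \<union> J))"
  proof -
    note [measurable] = measurable_cross[OF u(1) v(1)]
    have "(\<lambda>x. ennreal (exp (l * Re (c * cross d u v x)))) \<in> borel_measurable (leb_vec I)"
      by measurable
    thus ?thesis unfolding IJK(1) using measurable_cong_sets[OF sets_gauss_vec refl] by blast
  qed
  have merge: "ennreal (exp (l * Re (c * cross d u v (merge K J (x, y)))))
     = (\<Prod>n\<in>J. ennreal (exp (Re (y n * cnj (b x n)))))" for x y
  proof -
    have "l * Re (c * cross d u v (merge K J (x, y))) = (\<Sum>j<d. Re (of_real l * c * (y (u j) * cnj (x (v j)))))"
    proof -
      have "merge K J (x, y) (u j) = y (u j)" "merge K J (x, y) (v j) = x (v j)" if "j < d" for j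
        using that vK IJK(2) unfolding J_def by (auto simp: merge_def)
      hence "cross d u v (merge K J (x, y)) = (\<Sum>j<d. y (u j) * cnj (x (v j)))"
        unfolding cross_def by (intro sum.cong) auto
      hence "l * Re (c * cross d u v (merge K J (x, y))) = Re (of_real l * c * (\<Sum>j<d. y (u j) * cnj (x (v j))))"
        by (simp add: algebra_simps)
      thus ?thesis by (simp only: sum_distrib_left Re_sum)
    qed
    also have "\<dots> = (\<Sum>n\<in>J. Re (y n * cnj (b x n)))"
      unfolding J_def b_def by (subst sum.reindex[OF u(2)]) (auto simp: w algebra_simps intro!: sum.cong)
    finally have "exp (l * Re (c * cross d u v (merge K J (x, y)))) = (\<Prod>n\<in>J. exp (Re (y n * cnj (b x n))))"
      using IJK(4) by (simp only: exp_sum)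
    thus ?thesis by (simp only: prod_ennreal exp_ge_zero)
  qed
  have "(\<integral>\<^sup>+x. ennreal (exp (l * Re (c * cross d u v x))) \<partial>gauss_vec I)
      = (\<integral>\<^sup>+x. \<integral>\<^sup>+y. (\<Prod>n\<in>J. ennreal (exp (Re (y n * cnj (b x n))))) \<partial>gauss_vec J \<partial>gauss_vec K)"
    using gauss.product_nn_integral_fold[OF IJK(2-4) meas] unfolding IJK(1) merge .
  also have "\<dots> = (\<integral>\<^sup>+x. (\<Prod>n\<in>J. ennreal (exp ((cmod (b x n))\<^sup>2 / 4))) \<partial>gauss_vec K)"
  proof (rule nn_integral_cong)
    fix x
    have "(\<integral>\<^sup>+y. (\<Prod>n\<in>J. ennreal (exp (Re (y n * cnj (b x n))))) \<partial>gauss_vec J)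
        = (\<Prod>n\<in>J. \<integral>\<^sup>+z. ennreal (exp (Re (z * cnj (b x n)))) \<partial>std_gaussian)"
      by (rule gauss.product_nn_integral_prod[OF IJK(4)]) auto
    thus "(\<integral>\<^sup>+y. (\<Prod>n\<in>J. ennreal (exp (Re (y n * cnj (b x n))))) \<partial>gauss_vec J)
        = (\<Prod>n\<in>J. ennreal (exp ((cmod (b x n))\<^sup>2 / 4)))"
      using nn_integral_std_gaussian[of 0] by simp
  qed
  also have "\<dots> = (\<integral>\<^sup>+x. ennreal (exp (l\<^sup>2 / 4 * (\<Sum>i\<in>v ` {..<d}. (cmod (x i))\<^sup>2))) \<partial>gauss_vec K)"
  proof (rule nn_integral_cong)
    fix x
    have "(\<Prod>n\<in>J. ennreal (exp ((cmod (b x n))\<^sup>2 / 4))) = ennreal (exp (\<Sum>n\<in>J. (cmod (b x n))\<^sup>2 / 4))"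
      using IJK(4) by (simp add: prod_ennreal exp_sum)
    also have "(\<Sum>n\<in>J. (cmod (b x n))\<^sup>2 / 4) = (\<Sum>j<d. l\<^sup>2 / 4 * (cmod (x (v j)))\<^sup>2)"
      unfolding J_def b_def using c
      by (subst sum.reindex[OF u(2)]) (auto simp: w norm_mult power_mult_distrib intro!: sum.cong)
    also have "\<dots> = l\<^sup>2 / 4 * (\<Sum>i\<in>v ` {..<d}. (cmod (x i))\<^sup>2)"
      by (subst sum.reindex[OF v(2)]) (simp add: sum_distrib_left)
    finally show "(\<Prod>n\<in>J. ennreal (exp ((cmod (b x n))\<^sup>2 / 4))) = ennreal (exp (l\<^sup>2 / 4 * (\<Sum>i\<in>v ` {..<d}. (cmod (x i))\<^sup>2)))" .
  qed
  also have "\<dots> = ennreal ((1 / (1 - l\<^sup>2 / 4)) ^ d)"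
    using nn_integral_gauss_vec_exp_sum_sq[OF IJK(3) vK, of "l\<^sup>2 / 4"] l v(2) by (simp add: card_image)
  finally show ?thesis .
qed

lemma inverse_one_minus_le_exp:
  fixes x :: real
  assumes "0 \<le> x" "x \<le> 1/2"
  shows "1 / (1 - x) \<le> exp (x + 2 * x\<^sup>2)"
proof -
  have "exp (- x - 2 * x\<^sup>2) \<le> 1 - x"
    using ln_one_minus_pos_lower_bound[OF assms] assms by (simp add: ln_ge_iff)
  hence "1 / (1 - x) \<le> 1 / exp (- x - 2 * x\<^sup>2)" using assms by (intro divide_left_mono) auto
  also have "\<dots> = exp (x + 2 * x\<^sup>2)" by (simp add: exp_minus[symmetric] inverse_eq_divide[symmetric])
  finally show ?thesis .
qed

lemma inverse_one_plus_le_exp: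
  fixes x :: real
  assumes "0 \<le> x" "x \<le> 1"
  shows "1 / (1 + x) \<le> exp (- x + x\<^sup>2)"
proof -
  have "exp (x - x\<^sup>2) \<le> 1 + x"
    using ln_one_plus_pos_lower_bound[OF assms] assms by (simp add: ln_ge_iff)
  hence "1 / (1 + x) \<le> 1 / exp (x - x\<^sup>2)" using assms by (intro divide_left_mono) auto
  also have "\<dots> = exp (- x + x\<^sup>2)" by (simp add: exp_minus[symmetric] inverse_eq_divide[symmetric])
  finally show ?thesis .
qed

text \<open>
  Pairwise disjoint rows of a coordinate vector, with row indices in \<open>P\<close>: the \<open>j\<close>-th coordinate of row \<open>p\<close>
  sits at the place \<open>e p j\<close>.
\<close>

locale blocks =
  fixes I :: "nat set" and P :: "'p set" and e :: "'p \<Rightarrow> nat \<Rightarrow> nat" and d :: nat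
  assumes fin_I: "finite I" and fin_P: "finite P"
    and e_in: "\<And>p. p \<in> P \<Longrightarrow> e p ` {..<d} \<subseteq> I"
    and e_inj: "\<And>p. p \<in> P \<Longrightarrow> inj_on (e p) {..<d}"
    and e_disj: "\<And>p q. p \<in> P \<Longrightarrow> q \<in> P \<Longrightarrow> p \<noteq> q \<Longrightarrow> e p ` {..<d} \<inter> e q ` {..<d} = {}"
begin

definition gram :: "(nat \<Rightarrow> complex) \<Rightarrow> 'p \<Rightarrow> 'p \<Rightarrow> complex" where
  "gram x p q = cross d (e p) (e q) x"

text \<open>
  The deviation of the Gram matrix from its Gaussian expectation, \<open>d\<close> times the identity.
\<close>

definition deviation :: "(nat \<Rightarrow> complex) \<Rightarrow> 'p \<Rightarrow> 'p \<Rightarrow> complex" where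
  "deviation x p q = gram x p q - (if p = q then of_nat d else 0)"

lemma gram_measurable:
  assumes "p \<in> P" "q \<in> P"
  shows "(\<lambda>x. gram x p q) \<in> borel_measurable (leb_vec I)"
  unfolding gram_def using measurable_cross[OF e_in[OF assms(1)] e_in[OF assms(2)]] .

lemma Im_gram_same: "Im (gram x p p) = 0"
  by (simp add: gram_def cross_def)

text \<open>
  A sub-Gaussian bound, uniform over the entries and over the four phases \<open>c\<close>. The constant 2 is what
  \<open>inverse_one_minus_le_exp\<close> yields in the worst case \<open>p = q\<close>, \<open>c = 1\<close>. For \<open>p = q\<close> and \<open>c = \<plusminus>\<i>\<close> the
  exponent is 0, since the diagonal is real.
\<close>

lemma nn_integral_exp_deviation_le:
  assumes p: "p \<in> P" and q: "q \<in> P" and c: "c \<in> {1, -1, \<i>, -\<i>}" and l: "0 \<le> l" "l \<le> 1/2"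
  shows "(\<integral>\<^sup>+x. ennreal (exp (l * Re (c * deviation x p q))) \<partial>gauss_vec I) \<le> ennreal (exp (2 * l\<^sup>2 * d))"
proof (cases "p = q")
  case False
  have l2: "l\<^sup>2 \<le> 1" using l by (simp add: power_le_one)
  have "(\<integral>\<^sup>+x. ennreal (exp (l * Re (c * deviation x p q))) \<partial>gauss_vec I) = ennreal ((1 / (1 - l\<^sup>2 / 4)) ^ d)"
    using nn_integral_gauss_vec_exp_cross_distinct[OF fin_I e_in[OF p] e_inj[OF p] e_in[OF q] e_inj[OF q]
      e_disj[OF p q False], of c l] c l2 False
    by (auto simp: deviation_def gram_def)
  also have "(1 / (1 - l\<^sup>2 / 4)) ^ d \<le> exp (l\<^sup>2 / 4 + 2 * (l\<^sup>2 / 4)\<^sup>2) ^ d"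
    using l2 by (intro power_mono inverse_one_minus_le_exp) auto
  also have "\<dots> \<le> exp (2 * l\<^sup>2) ^ d"
  proof (intro power_mono, subst exp_le_cancel_iff)
    have "y / 4 + 2 * (y / 4)\<^sup>2 \<le> 2 * y" if "0 \<le> y" "y \<le> 1" for y :: real
      using mult_left_mono[OF that(2,1)] that by (simp add: power2_eq_square)
    from this[OF zero_le_power2 l2] show "l\<^sup>2 / 4 + 2 * (l\<^sup>2 / 4)\<^sup>2 \<le> 2 * l\<^sup>2" .
  qed simp
  also have "\<dots> = exp (2 * l\<^sup>2 * d)" by (simp add: exp_of_nat_mult[symmetric] mult_ac)
  finally show ?thesis by (simp add: ennreal_leI)
next
  case True
  have dev: "deviation x p q = of_real (Re (gram x p p) - d)" for x
    using True Im_gram_same[of x p] by (simp add: deviation_def complex_eq_iff)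
  have shift: "(\<integral>\<^sup>+x. ennreal (exp (m * (Re (gram x p p) - d))) \<partial>gauss_vec I)
     = ennreal (exp (- m * d) * (1 / (1 - m)) ^ d)" if m: "m < 1" for m
  proof -
    have meas: "(\<lambda>x. ennreal (exp (m * Re (gram x p p)))) \<in> borel_measurable (gauss_vec I)"
    proof -
      note [measurable] = gram_measurable[OF p p]
      have "(\<lambda>x. ennreal (exp (m * Re (gram x p p)))) \<in> borel_measurable (leb_vec I)" by measurable
      thus ?thesis using measurable_cong_sets[OF sets_gauss_vec refl] by blast
    qed
    have "(\<integral>\<^sup>+x. ennreal (exp (m * (Re (gram x p p) - d))) \<partial>gauss_vec I)
       = (\<integral>\<^sup>+x. ennreal (exp (- m * d)) * ennreal (exp (m * Re (gram x p p))) \<partial>gauss_vec I)"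
      by (intro nn_integral_cong) (simp add: ennreal_mult[symmetric] exp_add[symmetric] algebra_simps)
    also have "\<dots> = ennreal (exp (- m * d)) * ennreal ((1 / (1 - m)) ^ d)"
      using meas nn_integral_gauss_vec_exp_cross_same[OF fin_I e_in[OF p] e_inj[OF p] m]
      by (subst nn_integral_cmult) (auto simp: gram_def)
    finally show ?thesis using m by (simp add: ennreal_mult)
  qed
  consider "c = 1" | "c = -1" | "c = \<i> \<or> c = -\<i>" using c by auto
  thus ?thesis
  proof cases
    case 1
    have "(1 / (1 - l)) ^ d \<le> exp (l + 2 * l\<^sup>2) ^ d"
      using l by (intro power_mono inverse_one_minus_le_exp) auto
    also have "\<dots> = exp (l * d) * exp (2 * l\<^sup>2 * d)"
      by (simp add: exp_of_nat_mult[symmetric] exp_add[symmetric] algebra_simps)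
    finally have "exp (- l * d) * (1 / (1 - l)) ^ d \<le> exp (- l * d) * (exp (l * d) * exp (2 * l\<^sup>2 * d))"
      by (intro mult_left_mono) auto
    also have "\<dots> = exp (2 * l\<^sup>2 * d)" by (simp add: exp_add[symmetric])
    finally show ?thesis using 1 l shift[of l] by (simp add: dev ennreal_leI)
  next
    case 2
    have "(1 / (1 + l)) ^ d \<le> exp (- l + l\<^sup>2) ^ d"
      using l by (intro power_mono inverse_one_plus_le_exp) auto
    also have "\<dots> = exp (- l * d) * exp (l\<^sup>2 * d)"
      by (simp add: exp_of_nat_mult[symmetric] exp_add[symmetric] algebra_simps)
    also have "\<dots> \<le> exp (- l * d) * exp (2 * l\<^sup>2 * d)"
      by (intro mult_left_mono) (auto intro!: mult_right_mono)
    finally have "exp (l * d) * (1 / (1 + l)) ^ d \<le> exp (l * d) * (exp (- l * d) * exp (2 * l\<^sup>2 * d))"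
      by (intro mult_left_mono) auto
    also have "\<dots> = exp (2 * l\<^sup>2 * d)" by (simp add: exp_add[symmetric])
    finally show ?thesis using 2 l shift[of "-l"] by (simp add: dev ennreal_leI algebra_simps)
  next
    case 3
    hence "Re (c * deviation x p q) = 0" for x by (auto simp: dev)
    thus ?thesis using emeasure_gauss_vec_space[of I] by (simp add: one_ennreal_def[symmetric] ennreal_leI)
  qed
qed

text \<open>
  Chernoff's bound. The exponent \<open>2 l^2 - l \<eta>\<close> is minimal at \<open>l = \<eta> / 4\<close>, with value \<open>- \<eta>^2 / 8\<close>.
\<close>

lemma deviation_tail:
  fixes \<eta> :: real
  assumes p: "p \<in> P" and q: "q \<in> P" and c: "c \<in> {1, -1, \<i>, -\<i>}" and \<eta>: "0 \<le> \<eta>" "\<eta> \<le> 1"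
  shows "emeasure (gauss_vec I) {x \<in> space (gauss_vec I). Re (c * deviation x p q) \<ge> \<eta> * d} \<le> ennreal (exp (- (\<eta>\<^sup>2 / 8) * d))"
proof -
  define l where "l = \<eta> / 4"
  have markov: "1 \<le> ennreal (exp (- (l * t))) * ennreal (exp (l * y))" if "0 \<le> l" "t \<le> y" for l t y :: real
    using mult_left_mono[OF that(2,1)]
    by (simp add: ennreal_mult[symmetric] exp_add[symmetric])
  note [measurable] = gram_measurable[OF p q]
  have "(\<lambda>x. Re (c * deviation x p q)) \<in> borel_measurable (leb_vec I)"
    unfolding deviation_def by measurable
  hence [measurable]: "(\<lambda>x. Re (c * deviation x p q)) \<in> borel_measurable (gauss_vec I)"
    using measurable_cong_sets[OF sets_gauss_vec refl] by blast
  let ?S = "{x \<in> space (gauss_vec I). Re (c * deviation x p q) \<ge> \<eta> * d}"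
  have "emeasure (gauss_vec I) ?S = (\<integral>\<^sup>+x. indicator ?S x \<partial>gauss_vec I)"
    by (rule nn_integral_indicator[symmetric]) measurable
  also have "\<dots> \<le> (\<integral>\<^sup>+x. ennreal (exp (- (l * (\<eta> * d)))) * ennreal (exp (l * Re (c * deviation x p q))) \<partial>gauss_vec I)"
  proof (rule nn_integral_mono)
    fix x
    have "1 \<le> ennreal (exp (- (l * (\<eta> * d)))) * ennreal (exp (l * Re (c * deviation x p q)))" if "x \<in> ?S"
    proof (rule markov)
      show "0 \<le> l" using \<eta> by (simp add: l_def)
      show "\<eta> * d \<le> Re (c * deviation x p q)" using that by blast
    qed
    thus "indicator ?S x \<le> ennreal (exp (- (l * (\<eta> * d)))) * ennreal (exp (l * Re (c * deviation x p q)))"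
      by (cases "x \<in> ?S") (simp_all only: indicator_simps zero_le simp_thms not_False_eq_True)
  qed
  also have "\<dots> = ennreal (exp (- (l * (\<eta> * d)))) * (\<integral>\<^sup>+x. ennreal (exp (l * Re (c * deviation x p q))) \<partial>gauss_vec I)"
    by (rule nn_integral_cmult) measurable
  also have "\<dots> \<le> ennreal (exp (- (l * (\<eta> * d)))) * ennreal (exp (2 * l\<^sup>2 * d))"
    using \<eta> by (intro mult_left_mono nn_integral_exp_deviation_le p q c) (auto simp: l_def)
  also have "\<dots> = ennreal (exp (- (\<eta>\<^sup>2 / 8) * d))"
    by (simp add: ennreal_mult[symmetric] exp_add[symmetric] l_def power2_eq_square field_simps)
  finally show ?thesis .
qed

text \<open>
  Closeness to a multiple of the identity, measured relative to the trace so that the condition is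
  homogeneous in \<open>x\<close>. The strict inequality excludes vectors all of whose rows vanish.
\<close>

definition near_isotropic :: "real \<Rightarrow> (nat \<Rightarrow> complex) \<Rightarrow> bool" where
  "near_isotropic \<epsilon> x \<longleftrightarrow> (\<forall>p\<in>P. \<forall>q\<in>P.
     cmod (gram x p q - (if p = q then (\<Sum>r\<in>P. gram x r r) / card P else 0)) < \<epsilon> * Re (\<Sum>r\<in>P. gram x r r))"

lemma near_isotropic_measurable [measurable]: "{x \<in> space (leb_vec I). near_isotropic \<epsilon> x} \<in> sets (leb_vec I)"
proof -
  define T where "T = (\<lambda>x. \<Sum>r\<in>P. gram x r r)"
  have T [measurable]: "T \<in> borel_measurable (leb_vec I)"
    unfolding T_def by (intro borel_measurable_sum gram_measurable)
  have "{x \<in> space (leb_vec I). cmod (gram x p q - (if p = q then T x / card P else 0)) < \<epsilon> * Re (T x)} \<in> sets (leb_vec I)"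
    if "p \<in> P" "q \<in> P" for p q
  proof -
    note [measurable] = gram_measurable[OF that]
    show ?thesis by measurable
  qed
  thus ?thesis
    unfolding near_isotropic_def T_def by (intro sets.sets_Collect_finite_All fin_P)
qed

lemma gram_scale:
  assumes "p \<in> P" "q \<in> P"
  shows "gram (\<lambda>i\<in>I. c *\<^sub>R x i) p q = of_real (c\<^sup>2) * gram x p q"
proof -
  have "e p j \<in> I" "e q j \<in> I" if "j < d" for j using e_in[OF assms(1)] e_in[OF assms(2)] that by auto
  thus ?thesis
    unfolding gram_def cross_def sum_distrib_left
    by (intro sum.cong) (auto simp: scaleR_conv_of_real power2_eq_square)
qed

lemma near_isotropic_scale:
  assumes c: "c > 0"
  shows "near_isotropic \<epsilon> (\<lambda>i\<in>I. c *\<^sub>R x i) \<longleftrightarrow> near_isotropic \<epsilon> x"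
proof -
  let ?y = "\<lambda>i\<in>I. c *\<^sub>R x i" and ?T = "\<lambda>x. \<Sum>r\<in>P. gram x r r"
  have T: "?T ?y = of_real (c\<^sup>2) * ?T x"
    unfolding sum_distrib_left by (intro sum.cong) (auto simp: gram_scale)
  have "cmod (gram ?y p q - (if p = q then ?T ?y / card P else 0)) < \<epsilon> * Re (?T ?y)
    \<longleftrightarrow> cmod (gram x p q - (if p = q then ?T x / card P else 0)) < \<epsilon> * Re (?T x)"
    if "p \<in> P" "q \<in> P" for p q
  proof -
    have "gram ?y p q - (if p = q then ?T ?y / card P else 0)
        = of_real (c\<^sup>2) * (gram x p q - (if p = q then ?T x / card P else 0))"
      unfolding gram_scale[OF that] T by (simp add: right_diff_distrib)
    hence "cmod (gram ?y p q - (if p = q then ?T ?y / card P else 0))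
        = c\<^sup>2 * cmod (gram x p q - (if p = q then ?T x / card P else 0))"
      by (simp only: norm_mult norm_of_real abs_power2)
    moreover have "\<epsilon> * Re (?T ?y) = c\<^sup>2 * (\<epsilon> * Re (?T x))"
    proof -
      have Re: "Re (of_real a * z) = a * Re z" for a z by simp
      show ?thesis unfolding T Re by (simp only: mult_ac)
    qed
    ultimately show ?thesis using c by (simp only: mult_less_cancel_left_pos zero_less_power)
  qed
  thus ?thesis unfolding near_isotropic_def by blast
qed

text \<open>
  The four phases bound the real and imaginary parts, so every entry deviates by less than \<open>2 \<eta> d\<close>.
  The same holds for the mean of the diagonal entries, so the entries are within \<open>4 \<eta> d\<close> of the multiple of the
  identity with the same trace. As the trace is at least \<open>d / 2\<close>, the condition \<open>8 \<eta> \<le> \<epsilon>\<close> suffices.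
\<close>

lemma near_isotropic_if_deviation_small:
  fixes \<epsilon> \<eta> :: real
  assumes P: "P \<noteq> {}" and d: "d > 0" and \<epsilon>: "\<epsilon> > 0" and \<eta>: "0 < \<eta>" "\<eta> \<le> 1/2" "8 * \<eta> \<le> \<epsilon>"
    and small: "\<And>p q c. p \<in> P \<Longrightarrow> q \<in> P \<Longrightarrow> c \<in> {1, -1, \<i>, -\<i>} \<Longrightarrow> Re (c * deviation x p q) < \<eta> * d"
  shows "near_isotropic \<epsilon> x"
proof -
  let ?M = "real (card P)" and ?T = "\<Sum>r\<in>P. gram x r r"
  have "card P > 0" using P fin_P by (simp add: card_gt_0_iff)
  hence M: "?M \<ge> 1" by linarith
  have dev: "cmod (deviation x p q) < 2 * \<eta> * d" if "p \<in> P" "q \<in> P" for p q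
  proof -
    have "\<bar>Re (deviation x p q)\<bar> < \<eta> * d" "\<bar>Im (deviation x p q)\<bar> < \<eta> * d"
      using small[OF that, of 1] small[OF that, of "-1"] small[OF that, of \<i>] small[OF that, of "-\<i>"]
      by auto
    thus ?thesis using cmod_le[of "deviation x p q"] by linarith
  qed
  have T: "Re ?T \<ge> ?M * d / 2"
  proof -
    have "Re (gram x r r) \<ge> d / 2" if "r \<in> P" for r
    proof -
      have "Re (gram x r r) > d - \<eta> * d" using small[OF that that, of "-1"] by (simp add: deviation_def)
      moreover have "\<eta> * d \<le> 1 / 2 * d" using \<eta> by (intro mult_right_mono) auto
      ultimately show ?thesis by simp
    qed
    hence "(\<Sum>r\<in>P. Re (gram x r r)) \<ge> (\<Sum>r\<in>P. d / 2)" by (intro sum_mono)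
    thus ?thesis by simp
  qed
  have Tdev: "cmod (?T / ?M - d) \<le> 2 * \<eta> * d"
  proof -
    have "?T / ?M - d = (\<Sum>r\<in>P. deviation x r r) / ?M"
      using M by (simp add: deviation_def sum_subtractf diff_divide_distrib)
    hence "cmod (?T / ?M - d) = cmod (\<Sum>r\<in>P. deviation x r r) / ?M" by (simp add: norm_divide)
    also have "cmod (\<Sum>r\<in>P. deviation x r r) \<le> (\<Sum>r\<in>P. 2 * \<eta> * d)"
      by (rule sum_norm_le) (use dev in \<open>auto intro: less_imp_le\<close>)
    finally show ?thesis using M by (simp add: divide_right_mono field_simps)
  qed
  have "cmod (gram x p q - (if p = q then ?T / ?M else 0)) < 4 * \<eta> * d" if pq: "p \<in> P" "q \<in> P" for p q
  proof (cases "p = q")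
    case True
    have "gram x p q - ?T / ?M = deviation x p q - (?T / ?M - d)" using True by (simp add: deviation_def)
    hence "cmod (gram x p q - ?T / ?M) \<le> cmod (deviation x p q) + cmod (?T / ?M - d)"
      by (metis norm_triangle_ineq4)
    thus ?thesis using True dev[OF pq] Tdev by simp
  next
    case False
    have "0 < \<eta> * d" using \<eta> d by simp
    with False show ?thesis using dev[OF pq] by (simp add: deviation_def)
  qed
  moreover have "4 * \<eta> * d \<le> \<epsilon> * Re ?T"
  proof -
    have "4 * \<eta> * d = 8 * \<eta> * (d / 2)" by simp
    also have "\<dots> \<le> \<epsilon> * (?M * d / 2)"
      using \<eta> \<epsilon> M d by (intro mult_mono) auto
    also have "\<dots> \<le> \<epsilon> * Re ?T" using T \<epsilon> by (intro mult_left_mono) auto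
    finally show ?thesis .
  qed
  ultimately show ?thesis unfolding near_isotropic_def by fastforce
qed

lemma not_near_isotropic_prob:
  fixes \<epsilon> \<eta> :: real
  assumes P: "P \<noteq> {}" and d: "d > 0" and \<epsilon>: "\<epsilon> > 0" and \<eta>: "0 < \<eta>" "\<eta> \<le> 1/2" "8 * \<eta> \<le> \<epsilon>"
  shows "emeasure (gauss_vec I) {x \<in> space (gauss_vec I). \<not> near_isotropic \<epsilon> x} \<le>
    ennreal (4 * (card P)\<^sup>2 * exp (- (\<eta>\<^sup>2 / 8) * d))"
proof -
  let ?C = "{1, -1, \<i>, -\<i>} :: complex set"
  let ?S = "\<lambda>(p, q, c). {x \<in> space (gauss_vec I). Re (c * deviation x p q) \<ge> \<eta> * d}"
  let ?X = "P \<times> P \<times> ?C"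
  have meas: "?S t \<in> sets (gauss_vec I)" if tX: "t \<in> ?X" for t
  proof -
    obtain p q c where t: "t = (p, q, c)" "p \<in> P" "q \<in> P" using tX by blast
    note [measurable] = gram_measurable[OF t(2,3)]
    have "(\<lambda>x. Re (c * deviation x p q)) \<in> borel_measurable (leb_vec I)"
      unfolding deviation_def by measurable
    hence [measurable]: "(\<lambda>x. Re (c * deviation x p q)) \<in> borel_measurable (gauss_vec I)"
      using measurable_cong_sets[OF sets_gauss_vec refl] by blast
    show ?thesis unfolding t(1) prod.case by measurable
  qed
  have sub: "{x \<in> space (gauss_vec I). \<not> near_isotropic \<epsilon> x} \<subseteq> (\<Union>t\<in>?X. ?S t)"
  proof
    fix x assume x: "x \<in> {x \<in> space (gauss_vec I). \<not> near_isotropic \<epsilon> x}"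
    have "\<exists>p\<in>P. \<exists>q\<in>P. \<exists>c\<in>?C. \<not> Re (c * deviation x p q) < \<eta> * d"
    proof (rule ccontr)
      assume "\<not> ?thesis"
      hence "near_isotropic \<epsilon> x"
        by (intro near_isotropic_if_deviation_small[OF P d \<epsilon> \<eta>]) blast
      thus False using x by simp
    qed
    then obtain p q c where "p \<in> P" "q \<in> P" "c \<in> ?C" "\<not> Re (c * deviation x p q) < \<eta> * d" by blast
    hence "(p, q, c) \<in> ?X" "x \<in> ?S (p, q, c)" using x by (auto simp: not_less)
    thus "x \<in> (\<Union>t\<in>?X. ?S t)" by blast
  qed
  have "emeasure (gauss_vec I) {x \<in> space (gauss_vec I). \<not> near_isotropic \<epsilon> x} \<le> emeasure (gauss_vec I) (\<Union>t\<in>?X. ?S t)"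
    by (rule emeasure_mono[OF sub]) (use meas fin_P in \<open>auto intro!: sets.finite_UN\<close>)
  also have "\<dots> \<le> (\<Sum>t\<in>?X. emeasure (gauss_vec I) (?S t))"
    using fin_P meas by (intro emeasure_subadditive_finite) auto
  also have "\<dots> \<le> (\<Sum>t\<in>?X. ennreal (exp (- (\<eta>\<^sup>2 / 8) * d)))"
  proof (rule sum_mono)
    fix t assume t: "t \<in> ?X"
    obtain p q c where [simp]: "t = (p, q, c)" by (cases t)
    show "emeasure (gauss_vec I) (?S t) \<le> ennreal (exp (- (\<eta>\<^sup>2 / 8) * d))"
      using t deviation_tail[of p q c \<eta>] \<eta> by simp
  qed
  also have "\<dots> = ennreal (card ?X * exp (- (\<eta>\<^sup>2 / 8) * d))"
    by (simp add: ennreal_of_nat_eq_real_of_nat ennreal_mult)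
  also have "card ?X = 4 * (card P)\<^sup>2"
  proof -
    have "card ?C = 4" by (simp add: complex_eq_iff)
    thus ?thesis by (simp add: card_cartesian_product power2_eq_square)
  qed
  finally show ?thesis by simp
qed

end

section \<open>The realigned state as a function of the Gram matrix\<close>

lemma sum_lessThan_mult:
  fixes f :: "nat \<Rightarrow> 'a::comm_monoid_add"
  shows "(\<Sum>n<a * b. f n) = (\<Sum>i<a. \<Sum>j<b. f (i * b + j))"
proof -
  have "(\<Sum>n<a * b. f n) = (\<Sum>i<a. sum f {i * b..<i * b + b})"
    by (rule sum.nat_group[symmetric])
  also have "\<dots> = (\<Sum>i<a. \<Sum>j<b. f (i * b + j))"
  proof (rule sum.cong)
    fix i
    show "sum f {i * b..<i * b + b} = (\<Sum>j<b. f (i * b + j))"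
      using sum.shift_bounds_nat_ivl[of f 0 "i * b" b] by (simp add: add.commute atLeast0LessThan)
  qed simp
  finally show ?thesis .
qed

lemma mult_add_less:
  fixes i j a b :: nat
  assumes "i < a" "j < b" shows "i * b + j < a * b"
proof -
  have "i * b + j < (i + 1) * b" using assms by simp
  also have "\<dots> \<le> a * b" using assms by (intro mult_right_mono) auto
  finally show ?thesis .
qed

text \<open>
  The place of the coordinate \<open>e_i \<otimes> f_j \<otimes> g_a\<close>, for \<open>p = (i, a)\<close>, in the order of
  \<open>C^d1 \<otimes> C^d2 \<otimes> C^s\<close>.
\<close>

definition coord :: "nat \<Rightarrow> nat \<Rightarrow> nat \<times> nat \<Rightarrow> nat \<Rightarrow> nat" where
  "coord d2 s p j = (fst p * d2 + j) * s + snd p"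

text \<open>
  The reduced state of a vector that is given by its coordinate function.
\<close>

definition state_of :: "nat \<Rightarrow> nat \<Rightarrow> (nat \<Rightarrow> complex) \<Rightarrow> complex mat" where
  "state_of n s x = mat n n (\<lambda>(u, v). \<Sum>a<s. x (u * s + a) * cnj (x (v * s + a)))"

lemma state_of_vec: "partial_trace_snd n s (ket_bra (vec (n * s) x)) = state_of n s x"
proof (rule eq_matI)
  fix u v assume "u < dim_row (state_of n s x)" "v < dim_col (state_of n s x)"
  hence uv: "u < n" "v < n" by (auto simp: state_of_def)
  show "partial_trace_snd n s (ket_bra (vec (n * s) x)) $$ (u, v) = state_of n s x $$ (u, v)"
    using uv mult_add_less[of u n _ s] mult_add_less[of v n _ s]
    by (auto simp: partial_trace_snd_def ket_bra_def state_of_def intro!: sum.cong)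
qed (auto simp: partial_trace_snd_def state_of_def)

lemma realign_carrier [simp]: "realign d1 d2 A \<in> carrier_mat (d1\<^sup>2) (d2\<^sup>2)"
  by (simp add: realign_def)

lemma realign_state_index:
  assumes "r < d1\<^sup>2" "j < d2" "l < d2"
  shows "realign d1 d2 (state_of (d1 * d2) s x) $$ (r, j * d2 + l) =
    (\<Sum>a<s. x (coord d2 s (r div d1, a) j) * cnj (x (coord d2 s (r mod d1, a) l)))"
proof -
  have r: "r div d1 < d1" "r mod d1 < d1"
    using assms(1) by (auto simp: power2_eq_square less_mult_imp_div_less intro!: mod_less_divisor gr0I)
  have "j * d2 + l < d2\<^sup>2" using mult_add_less[OF assms(2,3)] by (simp add: power2_eq_square)
  moreover have "r div d1 * d2 + j < d1 * d2" "r mod d1 * d2 + l < d1 * d2"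
    using r assms mult_add_less by auto
  ultimately show ?thesis
    using assms by (simp add: realign_def Let_def state_of_def coord_def)
qed

text \<open>
  The matrix \<open>\<rho>^R (\<rho>^R)*\<close>, as a function of the Gram matrix \<open>g\<close> of the rows.
\<close>

definition gram_kernel :: "nat \<Rightarrow> nat \<Rightarrow> (nat \<times> nat \<Rightarrow> nat \<times> nat \<Rightarrow> complex) \<Rightarrow> nat \<Rightarrow> nat \<Rightarrow> complex" where
  "gram_kernel d1 s g r r' = (\<Sum>a<s. \<Sum>b<s.
     g (r div d1, a) (r' div d1, b) * cnj (g (r mod d1, a) (r' mod d1, b)))"

definition row_gram :: "nat \<Rightarrow> nat \<Rightarrow> (nat \<Rightarrow> complex) \<Rightarrow> nat \<times> nat \<Rightarrow> nat \<times> nat \<Rightarrow> complex" where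
  "row_gram d2 s x p q = cross d2 (coord d2 s p) (coord d2 s q) x"

text \<open>
  Expanding the product, the sums over the two factors \<open>j\<close> and \<open>l\<close> of the column index separate, and each
  of them is an inner product of two rows.
\<close>

lemma realign_gram_index:
  fixes d1 d2 s :: nat and x :: "nat \<Rightarrow> complex"
  assumes r: "r < d1\<^sup>2" "r' < d1\<^sup>2"
  defines "A \<equiv> realign d1 d2 (state_of (d1 * d2) s x)"
  shows "(A * mat_adjoint A) $$ (r, r') = gram_kernel d1 s (row_gram d2 s x) r r'"
proof -
  have A: "A \<in> carrier_mat (d1\<^sup>2) (d2\<^sup>2)" unfolding A_def by simp
  let ?x = "\<lambda>i a j. x (coord d2 s (i, a) j)"
  let ?i = "r div d1" and ?k = "r mod d1" and ?i' = "r' div d1" and ?k' = "r' mod d1"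
  have "(A * mat_adjoint A) $$ (r, r') = (\<Sum>c<d2 * d2. A $$ (r, c) * cnj (A $$ (r', c)))"
    using r A by (auto simp: scalar_prod_def atLeast0LessThan power2_eq_square intro!: sum.cong)
  also have "\<dots> = (\<Sum>j<d2. \<Sum>l<d2. A $$ (r, j * d2 + l) * cnj (A $$ (r', j * d2 + l)))"
    by (rule sum_lessThan_mult)
  also have "\<dots> = (\<Sum>j<d2. \<Sum>l<d2. (\<Sum>a<s. ?x ?i a j * cnj (?x ?k a l)) * (\<Sum>b<s. cnj (?x ?i' b j) * ?x ?k' b l))"
    unfolding A_def using r by (intro sum.cong refl) (simp add: realign_state_index)
  also have "\<dots> = (\<Sum>j<d2. \<Sum>l<d2. \<Sum>a<s. \<Sum>b<s.
      (?x ?i a j * cnj (?x ?i' b j)) * cnj (?x ?k a l * cnj (?x ?k' b l)))"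
    by (simp add: sum_product mult_ac)
  also have "\<dots> = (\<Sum>j<d2. \<Sum>a<s. \<Sum>l<d2. \<Sum>b<s.
      (?x ?i a j * cnj (?x ?i' b j)) * cnj (?x ?k a l * cnj (?x ?k' b l)))"
    by (intro sum.cong refl sum.swap)
  also have "\<dots> = (\<Sum>a<s. \<Sum>j<d2. \<Sum>l<d2. \<Sum>b<s.
      (?x ?i a j * cnj (?x ?i' b j)) * cnj (?x ?k a l * cnj (?x ?k' b l)))"
    by (rule sum.swap)
  also have "\<dots> = (\<Sum>a<s. \<Sum>j<d2. \<Sum>b<s. \<Sum>l<d2.
      (?x ?i a j * cnj (?x ?i' b j)) * cnj (?x ?k a l * cnj (?x ?k' b l)))"
    by (intro sum.cong refl sum.swap)
  also have "\<dots> = (\<Sum>a<s. \<Sum>b<s. \<Sum>j<d2. \<Sum>l<d2.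
      (?x ?i a j * cnj (?x ?i' b j)) * cnj (?x ?k a l * cnj (?x ?k' b l)))"
    by (intro sum.cong refl sum.swap)
  also have "\<dots> = gram_kernel d1 s (row_gram d2 s x) r r'"
    unfolding gram_kernel_def row_gram_def cross_def cnj_sum
    by (intro sum.cong refl) (simp add: sum_product)
  finally show ?thesis .
qed

definition kernel_trace :: "nat \<Rightarrow> nat \<Rightarrow> (nat \<times> nat \<Rightarrow> nat \<times> nat \<Rightarrow> complex) \<Rightarrow> real" where
  "kernel_trace d1 s g = Re (\<Sum>r<d1\<^sup>2. gram_kernel d1 s g r r)"

definition kernel_sq_trace :: "nat \<Rightarrow> nat \<Rightarrow> (nat \<times> nat \<Rightarrow> nat \<times> nat \<Rightarrow> complex) \<Rightarrow> real" where
  "kernel_sq_trace d1 s g = Re (\<Sum>r<d1\<^sup>2. \<Sum>r'<d1\<^sup>2. gram_kernel d1 s g r r' * gram_kernel d1 s g r' r)"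

lemma trace_norm_realign_lower:
  assumes "t > 0"
  shows "trace_norm (realign d1 d2 (state_of (d1 * d2) s x)) \<ge>
    3 / (2 * sqrt t) * kernel_trace d1 s (row_gram d2 s x)
    - 1 / (2 * t * sqrt t) * kernel_sq_trace d1 s (row_gram d2 s x)"
proof -
  let ?A = "realign d1 d2 (state_of (d1 * d2) s x)"
  let ?H = "?A * mat_adjoint ?A"
  have H: "?H \<in> carrier_mat (d1\<^sup>2) (d1\<^sup>2)" by (rule gram_carrier) (rule realign_carrier)
  have "Re (mtrace ?H) = kernel_trace d1 s (row_gram d2 s x)"
    using H by (simp add: mtrace_def kernel_trace_def realign_gram_index del: index_mult_mat Re_sum)
  moreover have "Re (mtrace (?H * ?H)) = kernel_sq_trace d1 s (row_gram d2 s x)"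
  proof -
    have "(?H * ?H) $$ (r, r) = (\<Sum>r'<d1\<^sup>2. ?H $$ (r, r') * ?H $$ (r', r))" if "r < d1\<^sup>2" for r
      using H that by (subst index_mult_mat) (auto simp: scalar_prod_def atLeast0LessThan simp del: index_mult_mat intro!: sum.cong)
    moreover have "dim_row (?H * ?H) = d1\<^sup>2" using H by (metis carrier_matD(1) index_mult_mat(2))
    ultimately show ?thesis
      by (simp add: mtrace_def kernel_sq_trace_def realign_gram_index del: index_mult_mat Re_sum)
  qed
  ultimately show ?thesis using trace_norm_lower[OF realign_carrier assms, of d1 d2 "state_of (d1 * d2) s x"] by simp
qed

lemma trace_norm_realign_upper:
  "trace_norm (realign d1 d2 (state_of (d1 * d2) s x)) \<le> sqrt (d1\<^sup>2 * kernel_trace d1 s (row_gram d2 s x))"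
proof -
  let ?A = "realign d1 d2 (state_of (d1 * d2) s x)"
  let ?H = "?A * mat_adjoint ?A"
  have H: "?H \<in> carrier_mat (d1\<^sup>2) (d1\<^sup>2)" by (rule gram_carrier) (rule realign_carrier)
  have "Re (mtrace ?H) = kernel_trace d1 s (row_gram d2 s x)"
    using H by (simp add: mtrace_def kernel_trace_def realign_gram_index del: index_mult_mat Re_sum)
  thus ?thesis using trace_norm_upper[OF realign_carrier, of d1 d2 "state_of (d1 * d2) s x"] by simp
qed

text \<open>
  The limiting Gram matrix: rows that are orthogonal and share the total squared length 1 equally.
\<close>

definition isotropic :: "nat \<Rightarrow> nat \<times> nat \<Rightarrow> nat \<times> nat \<Rightarrow> complex" where
  "isotropic m p q = (if p = q then 1 / of_nat m else 0)"

lemma gram_kernel_isotropic: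
  "gram_kernel d1 s (isotropic m) r r' = (if r = r' then of_nat s / (of_nat m)\<^sup>2 else 0)"
proof -
  have "(r div d1 = r' div d1 \<and> r mod d1 = r' mod d1) \<longleftrightarrow> r = r'"
    by (metis div_mult_mod_eq)
  moreover have "gram_kernel d1 s (isotropic m) r r' =
    (\<Sum>a<s. \<Sum>b<s. if a = b then (if r div d1 = r' div d1 \<and> r mod d1 = r' mod d1 then 1 / (of_nat m)\<^sup>2 else 0) else 0)"
    unfolding gram_kernel_def isotropic_def
    by (intro sum.cong refl) (auto simp: power2_eq_square)
  ultimately show ?thesis by (auto simp: sum.delta)
qed

lemma kernel_traces_isotropic:
  assumes "d1 > 0" "s > 0"
  shows "kernel_trace d1 s (isotropic (d1 * s)) = 1 / s"
    and "kernel_sq_trace d1 s (isotropic (d1 * s)) = 1 / ((real d1)\<^sup>2 * (real s)\<^sup>2)"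
proof -
  have 1: "of_nat s / (of_nat (d1 * s))\<^sup>2 = complex_of_real (1 / (d1\<^sup>2 * s))"
    using assms by (simp add: power2_eq_square)
  show "kernel_trace d1 s (isotropic (d1 * s)) = 1 / s"
    unfolding kernel_trace_def gram_kernel_isotropic 1 using assms by (simp del: of_real_divide)
  have "(\<Sum>r<d1\<^sup>2. \<Sum>r'<d1\<^sup>2. gram_kernel d1 s (isotropic (d1 * s)) r r' * gram_kernel d1 s (isotropic (d1 * s)) r' r)
      = (\<Sum>r<d1\<^sup>2. \<Sum>r'<d1\<^sup>2. if r = r' then complex_of_real ((1 / (d1\<^sup>2 * s))\<^sup>2) else 0)"
    unfolding gram_kernel_isotropic 1 by (intro sum.cong refl) (auto simp: power2_eq_square)
  also have "\<dots> = complex_of_real (d1\<^sup>2 * (1 / (d1\<^sup>2 * s))\<^sup>2)"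
    by simp
  also have "d1\<^sup>2 * (1 / (d1\<^sup>2 * s))\<^sup>2 = 1 / ((real d1)\<^sup>2 * (real s)\<^sup>2)"
    using assms by (simp add: power2_eq_square)
  finally show "kernel_sq_trace d1 s (isotropic (d1 * s)) = 1 / ((real d1)\<^sup>2 * (real s)\<^sup>2)"
    unfolding kernel_sq_trace_def by (metis Re_complex_of_real)
qed

lemma tendsto_gram_kernel:
  assumes "\<And>p q. p \<in> {..<d1} \<times> {..<s} \<Longrightarrow> q \<in> {..<d1} \<times> {..<s} \<Longrightarrow> (\<lambda>n. g n p q) \<longlonglongrightarrow> h p q"
    and "r < d1\<^sup>2" "r' < d1\<^sup>2"
  shows "(\<lambda>n. gram_kernel d1 s (g n) r r') \<longlonglongrightarrow> gram_kernel d1 s h r r'"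
proof -
  have "r div d1 < d1" "r mod d1 < d1" "r' div d1 < d1" "r' mod d1 < d1"
    using assms(2,3) by (auto simp: power2_eq_square less_mult_imp_div_less intro!: mod_less_divisor gr0I)
  thus ?thesis unfolding gram_kernel_def by (intro tendsto_intros assms(1)) auto
qed

text \<open>
  Quantifying over all Gram matrices, and not over vectors, is what makes \<open>\<epsilon>\<close> independent of the length of the
  rows. Sequences replace a topology on functions of which only the values on \<open>P\<close> matter.
\<close>

lemma eps_from_sequential_continuity:
  fixes F :: "('p \<Rightarrow> 'p \<Rightarrow> complex) \<Rightarrow> real"
  assumes cont: "\<And>g. (\<And>p q. p \<in> P \<Longrightarrow> q \<in> P \<Longrightarrow> (\<lambda>n. g n p q) \<longlonglongrightarrow> h p q) \<Longrightarrow> (\<lambda>n::nat. F (g n)) \<longlonglongrightarrow> F h"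
    and lim: "F h > b"
  shows "\<exists>\<epsilon>>0. \<forall>g. (\<forall>p\<in>P. \<forall>q\<in>P. cmod (g p q - h p q) < \<epsilon>) \<longrightarrow> F g > b"
proof (rule ccontr)
  assume neg: "\<not> ?thesis"
  have "\<forall>n. \<exists>g. (\<forall>p\<in>P. \<forall>q\<in>P. cmod (g p q - h p q) < 1 / real (Suc n)) \<and> \<not> F g > b"
  proof
    fix n
    have "1 / real (Suc n) > 0" by simp
    thus "\<exists>g. (\<forall>p\<in>P. \<forall>q\<in>P. cmod (g p q - h p q) < 1 / real (Suc n)) \<and> \<not> F g > b"
      using neg by blast
  qed
  then obtain g where g: "\<And>n p q. p \<in> P \<Longrightarrow> q \<in> P \<Longrightarrow> cmod (g n p q - h p q) < 1 / real (Suc n)" "\<And>n. \<not> F (g n) > b"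
    by metis
  have "(\<lambda>n. g n p q) \<longlonglongrightarrow> h p q" if "p \<in> P" "q \<in> P" for p q
  proof -
    have "(\<lambda>n. g n p q - h p q) \<longlonglongrightarrow> 0"
    proof (rule Lim_null_comparison)
      show "\<forall>\<^sub>F n in sequentially. norm (g n p q - h p q) \<le> inverse (real (Suc n))"
        using g(1)[OF that] by (intro always_eventually) (auto simp: inverse_eq_divide intro: less_imp_le)
      show "(\<lambda>n. inverse (real (Suc n))) \<longlonglongrightarrow> 0" by (rule LIMSEQ_inverse_real_of_nat)
    qed
    thus ?thesis by (simp add: LIM_zero_iff)
  qed
  from cont[OF this] have "(\<lambda>n. F (g n)) \<longlonglongrightarrow> F h" by simp
  from order_tendstoD(1)[OF this lim] have "\<forall>\<^sub>F n in sequentially. F (g n) > b" .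
  thus False using g(2) by (auto simp: eventually_sequentially)
qed

text \<open>
  The lower bound is taken at \<open>t = 1 / (d1^2 * s)\<close>, the only eigenvalue of \<open>\<rho>^R (\<rho>^R)*\<close> in the isotropic
  case; there it takes the value \<open>d1 / sqrt s > 1\<close>.
\<close>

lemma trace_norm_gt_1_near_isotropic:
  assumes d: "d1 > 0" "s > 0" and lt: "s < d1\<^sup>2"
  shows "\<exists>\<epsilon>>0. \<forall>d2 x. (\<forall>p\<in>{..<d1} \<times> {..<s}. \<forall>q\<in>{..<d1} \<times> {..<s}.
      cmod (row_gram d2 s x p q - isotropic (d1 * s) p q) < \<epsilon>)
    \<longrightarrow> trace_norm (realign d1 d2 (state_of (d1 * d2) s x)) > 1"
proof -
  define t where "t = 1 / (real (d1\<^sup>2) * s)"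
  have t: "t > 0" using d by (simp add: t_def)
  define F where "F = (\<lambda>g. 3 / (2 * sqrt t) * kernel_trace d1 s g - 1 / (2 * t * sqrt t) * kernel_sq_trace d1 s g)"
  have st: "sqrt t = 1 / (d1 * sqrt s)" by (simp add: t_def real_sqrt_divide real_sqrt_mult)
  have "F (isotropic (d1 * s)) = d1 / sqrt s"
  proof -
    define u where "u = sqrt (real s)"
    have u: "u > 0" "real s = u * u" using d by (auto simp: u_def)
    show ?thesis
      unfolding F_def kernel_traces_isotropic[OF d] st u_def[symmetric] unfolding t_def using u d
      by (simp add: power2_eq_square field_simps)
  qed
  also have "\<dots> > 1"
  proof -
    have "sqrt s < sqrt ((real d1)\<^sup>2)" using lt by (simp only: real_sqrt_less_iff) (metis of_nat_less_iff of_nat_power)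
    thus ?thesis using d by simp
  qed
  finally have "F (isotropic (d1 * s)) > 1" .
  hence "\<exists>\<epsilon>>0. \<forall>g. (\<forall>p\<in>{..<d1} \<times> {..<s}. \<forall>q\<in>{..<d1} \<times> {..<s}. cmod (g p q - isotropic (d1 * s) p q) < \<epsilon>) \<longrightarrow> F g > 1"
  proof (rule eps_from_sequential_continuity[rotated])
    fix g assume "\<And>p q. p \<in> {..<d1} \<times> {..<s} \<Longrightarrow> q \<in> {..<d1} \<times> {..<s} \<Longrightarrow> (\<lambda>n. g n p q) \<longlonglongrightarrow> isotropic (d1 * s) p q"
    note * = tendsto_gram_kernel[OF this]
    show "(\<lambda>n. F (g n)) \<longlonglongrightarrow> F (isotropic (d1 * s))"
      unfolding F_def kernel_trace_def kernel_sq_trace_def by (intro tendsto_intros *) auto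
  qed
  thus ?thesis using trace_norm_realign_lower[OF t] unfolding F_def by (meson less_le_trans)
qed

text \<open>
  In the isotropic case the upper bound is the square root of \<open>d1^2 / s < 1\<close>.
\<close>

lemma trace_norm_le_1_near_isotropic:
  assumes d: "d1 > 0" "s > 0" and gt: "s > d1\<^sup>2"
  shows "\<exists>\<epsilon>>0. \<forall>d2 x. (\<forall>p\<in>{..<d1} \<times> {..<s}. \<forall>q\<in>{..<d1} \<times> {..<s}.
      cmod (row_gram d2 s x p q - isotropic (d1 * s) p q) < \<epsilon>)
    \<longrightarrow> trace_norm (realign d1 d2 (state_of (d1 * d2) s x)) \<le> 1"
proof -
  define F where "F = (\<lambda>g. - (real (d1\<^sup>2) * kernel_trace d1 s g))"
  have "F (isotropic (d1 * s)) > -1"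
    unfolding F_def kernel_traces_isotropic[OF d] using gt d by (simp add: divide_less_eq)
  hence "\<exists>\<epsilon>>0. \<forall>g. (\<forall>p\<in>{..<d1} \<times> {..<s}. \<forall>q\<in>{..<d1} \<times> {..<s}. cmod (g p q - isotropic (d1 * s) p q) < \<epsilon>) \<longrightarrow> F g > -1"
  proof (rule eps_from_sequential_continuity[rotated])
    fix g assume "\<And>p q. p \<in> {..<d1} \<times> {..<s} \<Longrightarrow> q \<in> {..<d1} \<times> {..<s} \<Longrightarrow> (\<lambda>n. g n p q) \<longlonglongrightarrow> isotropic (d1 * s) p q"
    note * = tendsto_gram_kernel[OF this]
    show "(\<lambda>n. F (g n)) \<longlonglongrightarrow> F (isotropic (d1 * s))"
      unfolding F_def kernel_trace_def by (intro tendsto_intros *) auto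
  qed
  then obtain \<epsilon> where \<epsilon>: "\<epsilon> > 0"
    "\<And>g. (\<forall>p\<in>{..<d1} \<times> {..<s}. \<forall>q\<in>{..<d1} \<times> {..<s}. cmod (g p q - isotropic (d1 * s) p q) < \<epsilon>) \<Longrightarrow> F g > -1"
    by blast
  have "trace_norm (realign d1 d2 (state_of (d1 * d2) s x)) \<le> 1"
    if "\<forall>p\<in>{..<d1} \<times> {..<s}. \<forall>q\<in>{..<d1} \<times> {..<s}. cmod (row_gram d2 s x p q - isotropic (d1 * s) p q) < \<epsilon>" for d2 x
  proof -
    have "(real d1)\<^sup>2 * kernel_trace d1 s (row_gram d2 s x) \<le> 1" using \<epsilon>(2)[OF that] by (simp add: F_def)
    hence "sqrt ((real d1)\<^sup>2 * kernel_trace d1 s (row_gram d2 s x)) \<le> 1" by simp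
    thus ?thesis using trace_norm_realign_upper[of d1 d2 s x] by linarith
  qed
  thus ?thesis using \<epsilon>(1) by blast
qed

section \<open>Measurability\<close>

text \<open>
  Measurability into \<open>borel_mat m n\<close>, in a form that can be checked one entry at a time and passes through
  matrix operations.
\<close>

definition entrywise_measurable :: "'a measure \<Rightarrow> nat \<Rightarrow> nat \<Rightarrow> ('a \<Rightarrow> complex mat) \<Rightarrow> bool" where
  "entrywise_measurable M m n f \<longleftrightarrow> (\<forall>x\<in>space M. f x \<in> carrier_mat m n) \<and>
     (\<forall>i<m. \<forall>j<n. (\<lambda>x. f x $$ (i, j)) \<in> borel_measurable M)"

lemma entrywise_measurable_mult:
  assumes f: "entrywise_measurable M l m f" and g: "entrywise_measurable M m n g"
  shows "entrywise_measurable M l n (\<lambda>x. f x * g x)"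
  unfolding entrywise_measurable_def
proof (intro conjI ballI allI impI)
  show "f x * g x \<in> carrier_mat l n" if "x \<in> space M" for x
    using that f g unfolding entrywise_measurable_def by (meson mult_carrier_mat)
next
  fix i j assume ij: "i < l" "j < n"
  have "(\<lambda>x. \<Sum>k<m. f x $$ (i, k) * g x $$ (k, j)) \<in> borel_measurable M"
    using f g ij unfolding entrywise_measurable_def
    by (intro borel_measurable_sum borel_measurable_times) auto
  also have "?this \<longleftrightarrow> (\<lambda>x. (f x * g x) $$ (i, j)) \<in> borel_measurable M"
  proof (rule measurable_cong)
    fix x assume "x \<in> space M"
    hence "f x \<in> carrier_mat l m" "g x \<in> carrier_mat m n"
      using f g unfolding entrywise_measurable_def by auto
    thus "(\<Sum>k<m. f x $$ (i, k) * g x $$ (k, j)) = (f x * g x) $$ (i, j)"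
      using ij by (auto simp: scalar_prod_def atLeast0LessThan intro!: sum.cong)
  qed
  finally show "(\<lambda>x. (f x * g x) $$ (i, j)) \<in> borel_measurable M" .
qed

lemma entrywise_measurable_adjoint:
  assumes f: "entrywise_measurable M m n f"
  shows "entrywise_measurable M n m (\<lambda>x. mat_adjoint (f x))"
  unfolding entrywise_measurable_def
proof (intro conjI ballI allI impI)
  show "mat_adjoint (f x) \<in> carrier_mat n m" if "x \<in> space M" for x
    using that f unfolding entrywise_measurable_def by auto
next
  fix i j assume ij: "i < n" "j < m"
  have "(\<lambda>x. cnj (f x $$ (j, i))) \<in> borel_measurable M"
    using f ij unfolding entrywise_measurable_def by (intro measurable_cnj) auto
  also have "?this \<longleftrightarrow> (\<lambda>x. mat_adjoint (f x) $$ (i, j)) \<in> borel_measurable M"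
    using f ij unfolding entrywise_measurable_def by (intro measurable_cong) auto
  finally show "(\<lambda>x. mat_adjoint (f x) $$ (i, j)) \<in> borel_measurable M" .
qed

lemma entrywise_measurable_pow:
  assumes f: "entrywise_measurable M n n f"
  shows "entrywise_measurable M n n (\<lambda>x. f x ^\<^sub>m k)"
proof (induction k)
  case 0
  have "(\<lambda>x. (f x ^\<^sub>m 0) $$ (i, j)) \<in> borel_measurable M" if "i < n" "j < n" for i j
  proof -
    have "(\<lambda>x. if i = j then 1 else (0::complex)) \<in> borel_measurable M" by simp
    also have "?this \<longleftrightarrow> (\<lambda>x. (f x ^\<^sub>m 0) $$ (i, j)) \<in> borel_measurable M"
      using f that unfolding entrywise_measurable_def by (intro measurable_cong) auto
    finally show ?thesis .
  qed
  thus ?case using f unfolding entrywise_measurable_def by auto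
next
  case (Suc k)
  from entrywise_measurable_mult[OF Suc f] show ?case by simp
qed

lemma measurable_mtrace:
  assumes f: "entrywise_measurable M n n f"
  shows "(\<lambda>x. mtrace (f x)) \<in> borel_measurable M"
proof -
  have "(\<lambda>x. \<Sum>i<n. f x $$ (i, i)) \<in> borel_measurable M"
    using f unfolding entrywise_measurable_def by (intro borel_measurable_sum) auto
  also have "?this \<longleftrightarrow> (\<lambda>x. mtrace (f x)) \<in> borel_measurable M"
    using f unfolding entrywise_measurable_def mtrace_def by (intro measurable_cong) auto
  finally show ?thesis .
qed

lemma measurable_trace_norm:
  assumes f: "entrywise_measurable M m n f"
  shows "(\<lambda>x. trace_norm (f x)) \<in> borel_measurable M"
proof (rule borel_measurable_LIMSEQ_real)
  let ?t = "\<lambda>x i. Re (mtrace ((mat_adjoint (f x) * f x) ^\<^sub>m i))"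
  show "(\<lambda>k. trace_norm_approx (?t x) k) \<longlonglongrightarrow> trace_norm (f x)" if "x \<in> space M" for x
    using that f trace_norm_tendsto[of "f x" m n] unfolding entrywise_measurable_def by auto
  have t: "(\<lambda>x. ?t x i) \<in> borel_measurable M" for i
  proof -
    have "Re \<in> borel_measurable borel" by measurable
    with measurable_mtrace[OF entrywise_measurable_pow[OF entrywise_measurable_mult[OF
        entrywise_measurable_adjoint[OF f] f]]]
    show ?thesis by (rule measurable_compose)
  qed
  have "(sqrt :: real \<Rightarrow> real) \<in> borel_measurable borel" by measurable
  note sqrt_t = measurable_compose[OF t this]
  show "(\<lambda>x. trace_norm_approx (?t x) k) \<in> borel_measurable M" for k
    unfolding trace_norm_approx_def
    by (intro borel_measurable_times borel_measurable_sum borel_measurable_divide borel_measurable_power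
        sqrt_t measurable_const t) auto
qed

lemma entrywise_measurable_borel_mat: "entrywise_measurable (borel_mat m n) m n (\<lambda>A. A)"
  unfolding entrywise_measurable_def
proof (intro conjI ballI allI impI)
  show "A \<in> carrier_mat m n" if "A \<in> space (borel_mat m n)" for A
    using that by (simp add: borel_mat_def)
next
  fix i j assume ij: "i < m" "j < n"
  have "(\<lambda>A. \<lambda>ij\<in>{..<m} \<times> {..<n}. A $$ ij) \<in> measurable (borel_mat m n) (\<Pi>\<^sub>M ij\<in>{..<m} \<times> {..<n}. borel)"
    unfolding borel_mat_def by (rule measurable_vimage_algebra1) (auto simp: space_PiM)
  from measurable_compose[OF this measurable_component_singleton[of "(i, j)"]] ij
  show "(\<lambda>A. A $$ (i, j)) \<in> borel_measurable (borel_mat m n)" by simp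
qed

lemma measurable_borel_matI:
  assumes "entrywise_measurable M m n f"
  shows "f \<in> measurable M (borel_mat m n)"
  unfolding borel_mat_def
proof (rule measurable_vimage_algebra2)
  show "f \<in> space M \<rightarrow> carrier_mat m n" using assms by (auto simp: entrywise_measurable_def)
  show "(\<lambda>x. \<lambda>ij\<in>{..<m} \<times> {..<n}. f x $$ ij) \<in> measurable M (\<Pi>\<^sub>M ij\<in>{..<m} \<times> {..<n}. borel)"
    using assms by (intro measurable_restrict) (auto simp: entrywise_measurable_def)
qed

lemma measurable_borel_vec_index: "i < n \<Longrightarrow> (\<lambda>v. v $ i) \<in> borel_measurable (borel_vec n)"
proof -
  assume i: "i < n"
  have "(\<lambda>v. \<lambda>i\<in>{..<n}. v $ i) \<in> measurable (borel_vec n) (\<Pi>\<^sub>M i\<in>{..<n}. borel)"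
    unfolding borel_vec_def by (rule measurable_vimage_algebra1) (auto simp: space_PiM)
  from measurable_compose[OF this measurable_component_singleton[of i]] i
  show "(\<lambda>v. v $ i) \<in> borel_measurable (borel_vec n)" by simp
qed

lemma measurable_borel_vecI:
  assumes "\<And>i. i < n \<Longrightarrow> (\<lambda>x. f x i) \<in> borel_measurable M"
  shows "(\<lambda>x. vec n (f x)) \<in> measurable M (borel_vec n)"
  unfolding borel_vec_def
proof (rule measurable_vimage_algebra2)
  have "(\<lambda>x. \<lambda>i\<in>{..<n}. f x i) \<in> measurable M (\<Pi>\<^sub>M i\<in>{..<n}. borel)"
    using assms by (intro measurable_restrict) auto
  also have "(\<lambda>x. \<lambda>i\<in>{..<n}. f x i) = (\<lambda>x. \<lambda>i\<in>{..<n}. vec n (f x) $ i)" by (auto simp: restrict_def fun_eq_iff)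
  finally show "(\<lambda>x. \<lambda>i\<in>{..<n}. vec n (f x) $ i) \<in> measurable M (\<Pi>\<^sub>M i\<in>{..<n}. borel)" .
qed auto

lemma measurable_reduced_state:
  "(\<lambda>\<psi>. partial_trace_snd n s (ket_bra \<psi>)) \<in> measurable (borel_vec (n * s)) (borel_mat n n)"
proof (rule measurable_borel_matI, unfold entrywise_measurable_def, intro conjI ballI allI impI)
  fix u v assume uv: "u < n" "v < n"
  have "(\<lambda>\<psi>. \<Sum>a<s. \<psi> $ (u * s + a) * cnj (\<psi> $ (v * s + a))) \<in> borel_measurable (borel_vec (n * s))"
    using uv by (intro borel_measurable_sum borel_measurable_times measurable_cnj measurable_borel_vec_index mult_add_less) auto
  also have "?this \<longleftrightarrow> (\<lambda>\<psi>. partial_trace_snd n s (ket_bra \<psi>) $$ (u, v)) \<in> borel_measurable (borel_vec (n * s))"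
    using uv mult_add_less[of u n _ s] mult_add_less[of v n _ s]
    by (intro measurable_cong) (auto simp: partial_trace_snd_def ket_bra_def borel_vec_def intro!: sum.cong)
  finally show "(\<lambda>\<psi>. partial_trace_snd n s (ket_bra \<psi>) $$ (u, v)) \<in> borel_measurable (borel_vec (n * s))" .
qed (auto simp: partial_trace_snd_def)

lemma entrywise_measurable_realign:
  "entrywise_measurable (borel_mat (d1 * d2) (d1 * d2)) (d1\<^sup>2) (d2\<^sup>2) (realign d1 d2)"
  unfolding entrywise_measurable_def
proof (intro conjI ballI allI impI)
  fix r c assume rc: "r < d1\<^sup>2" "c < d2\<^sup>2"
  have "r div d1 < d1" "r mod d1 < d1" "c div d2 < d2" "c mod d2 < d2"
    using rc by (auto simp: power2_eq_square less_mult_imp_div_less intro!: mod_less_divisor gr0I)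
  hence "(\<lambda>A. A $$ (r div d1 * d2 + c div d2, r mod d1 * d2 + c mod d2)) \<in> borel_measurable (borel_mat (d1 * d2) (d1 * d2))"
    using entrywise_measurable_borel_mat[of "d1 * d2" "d1 * d2"] mult_add_less
    unfolding entrywise_measurable_def by blast
  thus "(\<lambda>A. realign d1 d2 A $$ (r, c)) \<in> borel_measurable (borel_mat (d1 * d2) (d1 * d2))"
    using rc by (simp add: realign_def Let_def)
qed simp

section \<open>Random states\<close>

lemma coord_less:
  assumes "p \<in> {..<d1} \<times> {..<s}" "j < d2"
  shows "coord d2 s p j < d1 * d2 * s"
  using assms by (auto simp: coord_def intro!: mult_add_less)

lemma coord_inj:
  assumes "p \<in> {..<d1} \<times> {..<s}" "q \<in> {..<d1} \<times> {..<s}" "j < d2" "k < d2"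
    and eq: "coord d2 s p j = coord d2 s q k"
  shows "p = q \<and> j = k"
proof -
  have a: "snd p < s" "snd q < s" using assms by auto
  have "snd p = snd q"
    using arg_cong[OF eq, of "\<lambda>n. n mod s"] a by (simp add: coord_def)
  moreover have eq': "fst p * d2 + j = fst q * d2 + k"
    using arg_cong[OF eq, of "\<lambda>n. n div s"] a by (simp add: coord_def)
  have "j = k" using arg_cong[OF eq', of "\<lambda>n. n mod d2"] assms(3,4) by simp
  moreover have "fst p = fst q" using arg_cong[OF eq', of "\<lambda>n. n div d2"] assms(3,4) by simp
  ultimately show ?thesis by (simp add: prod_eq_iff)
qed

lemma blocks_coord: "blocks {..<d1 * d2 * s} ({..<d1} \<times> {..<s}) (coord d2 s) d2"
proof
  show "coord d2 s p ` {..<d2} \<subseteq> {..<d1 * d2 * s}" if "p \<in> {..<d1} \<times> {..<s}" for p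
    using coord_less[OF that] by auto
  show "inj_on (coord d2 s p) {..<d2}" if "p \<in> {..<d1} \<times> {..<s}" for p
    using coord_inj[OF that that] by (auto intro!: inj_onI)
  show "coord d2 s p ` {..<d2} \<inter> coord d2 s q ` {..<d2} = {}"
    if "p \<in> {..<d1} \<times> {..<s}" "q \<in> {..<d1} \<times> {..<s}" "p \<noteq> q" for p q
    using coord_inj[OF that(1,2)] that(3) by fastforce
qed auto

text \<open>
  Every coordinate belongs to exactly one row, so the squared lengths of the rows add up to that of the whole
  vector.
\<close>

lemma sum_row_gram:
  "(\<Sum>p\<in>{..<d1} \<times> {..<s}. row_gram d2 s x p p) = of_real (sq_norm {..<d1 * d2 * s} x)"
proof -
  have "sq_norm {..<d1 * d2 * s} x = (\<Sum>i<d1. \<Sum>j<d2. \<Sum>a<s. (cmod (x ((i * d2 + j) * s + a)))\<^sup>2)"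
    unfolding sq_norm_def by (simp only: sum_lessThan_mult)
  also have "\<dots> = (\<Sum>i<d1. \<Sum>a<s. \<Sum>j<d2. (cmod (x ((i * d2 + j) * s + a)))\<^sup>2)"
    by (intro sum.cong refl sum.swap)
  finally have "of_real (sq_norm {..<d1 * d2 * s} x)
     = (\<Sum>i<d1. \<Sum>a<s. \<Sum>j<d2. x ((i * d2 + j) * s + a) * cnj (x ((i * d2 + j) * s + a)))"
    by (simp add: complex_norm_square[symmetric] del: complex_mult_cnj)
  also have "\<dots> = (\<Sum>p\<in>{..<d1} \<times> {..<s}. row_gram d2 s x p p)"
    by (simp add: sum.cartesian_product' row_gram_def cross_def coord_def)
  finally show ?thesis ..
qed

lemma row_gram_divide:
  "row_gram d2 s (\<lambda>i. x i / of_real r) p q = row_gram d2 s x p q / of_real (r\<^sup>2)"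
  unfolding row_gram_def cross_def by (simp add: sum_divide_distrib power2_eq_square)

text \<open>
  The random state is the image of a uniform point \<open>x\<close> of the ball. Dividing \<open>x\<close> by its length divides its Gram
  matrix by \<open>|x|^2\<close>, the trace of that matrix, so \<open>near_isotropic\<close> for \<open>x\<close> becomes closeness to \<open>isotropic\<close>
  for the unit vector. The exceptional set is a cone, so its probability can be computed with the Gaussian measure.
\<close>

lemma random_state_prob:
  fixes d1 d2 s :: nat and \<epsilon> \<eta> :: real
  assumes d: "d1 > 0" "d2 > 0" "s > 0" and \<epsilon>: "\<epsilon> > 0" and \<eta>: "0 < \<eta>" "\<eta> \<le> 1/2" "8 * \<eta> \<le> \<epsilon>"
    and S: "S \<in> sets (borel_mat (d1 * d2) (d1 * d2))"
    and good: "\<And>x. (\<forall>p\<in>{..<d1} \<times> {..<s}. \<forall>q\<in>{..<d1} \<times> {..<s}.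
        cmod (row_gram d2 s x p q - isotropic (d1 * s) p q) < \<epsilon>) \<Longrightarrow> state_of (d1 * d2) s x \<in> S"
  shows "measure (random_state (d1 * d2) s) S \<ge> 1 - 4 * (d1 * s)\<^sup>2 * exp (- (\<eta>\<^sup>2 / 8) * d2)"
proof -
  define n N where "n = d1 * d2" and "N = n * s"
  define P where "P = {..<d1} \<times> {..<s}"
  let ?L = "leb_vec {..<N}" and ?r = "\<lambda>x. L2_set (\<lambda>i. cmod (x i)) {..<N}"
  let ?U = "uniform_measure ?L (unit_ball N)"
  let ?G = "\<lambda>x. vec N (\<lambda>i. x i / of_real (?r x)) :: complex vec"
  let ?F = "\<lambda>\<psi>. partial_trace_snd n s (ket_bra \<psi>)"
  interpret B: blocks "{..<N}" P "coord d2 s" d2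
    unfolding N_def n_def P_def by (rule blocks_coord)
  have P: "P \<noteq> {}" "card P = d1 * s" using d by (auto simp: P_def)
  have vol: "emeasure ?L (unit_ball N) \<noteq> 0" "emeasure ?L (unit_ball N) \<noteq> \<infinity>"
    unfolding emeasure_unit_ball by (auto simp: ennreal_eq_0_iff not_le)
  interpret U: prob_space ?U by (rule prob_space_uniform_measure[OF vol])
  have r: "?r x = sqrt (sq_norm {..<N} x)" for x by (simp add: L2_set_def sq_norm_def)
  have G: "?G \<in> measurable ?U (borel_vec N)"
  proof (rule measurable_borel_vecI)
    fix i assume "i < N"
    hence [measurable]: "(\<lambda>x. x i) \<in> borel_measurable ?L"
      using measurable_component_singleton[of i "{..<N}" "\<lambda>_. lborel"] by simp
    have "(\<lambda>x. x i / complex_of_real (?r x)) \<in> borel_measurable ?L" unfolding r by measurable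
    thus "(\<lambda>x. x i / complex_of_real (?r x)) \<in> borel_measurable ?U"
      using measurable_cong_sets[OF sets_uniform_measure refl] by blast
  qed
  have F: "?F \<in> measurable (borel_vec N) (borel_mat n n)"
    unfolding N_def by (rule measurable_reduced_state)
  have "random_state n s = distr ?U (borel_mat n n) (?F \<circ> ?G)"
    unfolding random_state_def uniform_sphere_def N_def[symmetric] by (rule distr_distr[OF F G])
  hence m: "measure (random_state n s) S = measure ?U ((?F \<circ> ?G) -` S \<inter> space ?U)"
    using S measurable_comp[OF G F] by (simp add: measure_distr n_def)
  let ?E = "{x \<in> space ?L. \<not> B.near_isotropic \<epsilon> x}"
  have E: "?E \<in> sets ?L" by (intro sets.sets_Collect_neg B.near_isotropic_measurable)
  have "emeasure ?U ?E = emeasure (gauss_vec {..<N}) ?E"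
  proof (rule emeasure_uniform_ball_cone[OF E])
    fix x c assume x: "x \<in> space ?L" and c: "(c::real) > 0"
    have "(\<lambda>i\<in>{..<N}. c *\<^sub>R x i) \<in> space ?L" by (simp add: space_PiM)
    thus "(\<lambda>i\<in>{..<N}. c *\<^sub>R x i) \<in> ?E \<longleftrightarrow> x \<in> ?E"
      using x B.near_isotropic_scale[OF c] by simp
  qed
  also have "\<dots> \<le> ennreal (4 * (card P)\<^sup>2 * exp (- (\<eta>\<^sup>2 / 8) * d2))"
    using B.not_near_isotropic_prob[OF P(1) d(2) \<epsilon> \<eta>] by (simp add: space_PiM)
  finally have "measure ?U ?E \<le> 4 * (card P)\<^sup>2 * exp (- (\<eta>\<^sup>2 / 8) * d2)"
    by (simp add: U.emeasure_eq_measure)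
  moreover have "measure ?U (space ?U - ?E) = 1 - measure ?U ?E"
    using E by (intro U.prob_compl) simp
  moreover have "measure ?U (space ?U - ?E) \<le> measure ?U ((?F \<circ> ?G) -` S \<inter> space ?U)"
  proof (rule U.finite_measure_mono)
    show "(?F \<circ> ?G) -` S \<inter> space ?U \<in> sets ?U"
      using S measurable_sets[OF measurable_comp[OF G F]] by (simp add: n_def)
    show "space ?U - ?E \<subseteq> (?F \<circ> ?G) -` S \<inter> space ?U"
    proof
      fix x assume x: "x \<in> space ?U - ?E"
      hence iso: "B.near_isotropic \<epsilon> x" by simp
      let ?Q = "sq_norm {..<N} x"
      have gram: "B.gram x p q = row_gram d2 s x p q" for p q
        by (simp add: B.gram_def row_gram_def)
      have total: "(\<Sum>p\<in>P. row_gram d2 s x p p) = of_real ?Q"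
        unfolding P_def N_def n_def by (rule sum_row_gram)
      have near: "cmod (row_gram d2 s x p q - (if p = q then of_real ?Q / of_nat (d1 * s) else 0)) < \<epsilon> * ?Q"
        if "p \<in> P" "q \<in> P" for p q
        using iso that unfolding B.near_isotropic_def gram total P(2) Re_complex_of_real by blast
      have Q: "?Q > 0"
      proof -
        obtain p where "p \<in> P" using P(1) by blast
        hence "0 < \<epsilon> * ?Q" using near[of p p] norm_ge_zero le_less_trans by blast
        thus ?thesis using \<epsilon> by (simp add: zero_less_mult_iff)
      qed
      have "cmod (row_gram d2 s (\<lambda>i. x i / of_real (?r x)) p q - isotropic (d1 * s) p q) < \<epsilon>"
        if "p \<in> P" "q \<in> P" for p q
      proof -
        have "row_gram d2 s (\<lambda>i. x i / of_real (?r x)) p q = row_gram d2 s x p q / of_real ?Q"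
          unfolding row_gram_divide r using Q by simp
        hence "row_gram d2 s (\<lambda>i. x i / of_real (?r x)) p q - isotropic (d1 * s) p q
           = (row_gram d2 s x p q - (if p = q then of_real ?Q / of_nat (d1 * s) else 0)) / of_real ?Q"
          using Q by (simp add: isotropic_def diff_divide_distrib)
        also have "cmod \<dots> = cmod (row_gram d2 s x p q - (if p = q then of_real ?Q / of_nat (d1 * s) else 0)) / ?Q"
          using Q by (simp only: norm_divide norm_of_real abs_of_pos)
        also have "\<dots> < \<epsilon>" using near[OF that] Q by (simp only: pos_divide_less_eq)
        finally show ?thesis .
      qed
      hence "state_of n s (\<lambda>i. x i / of_real (?r x)) \<in> S"
        unfolding n_def P_def by (intro good) blast
      thus "x \<in> (?F \<circ> ?G) -` S \<inter> space ?U"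
        using x by (simp add: N_def state_of_vec)
    qed
  qed
  ultimately show ?thesis using m unfolding P(2) n_def by simp
qed

lemma trace_norm_realign_events:
  "{\<rho> \<in> space (random_state (d1 * d2) s). trace_norm (realign d1 d2 \<rho>) > 1} \<in> sets (borel_mat (d1 * d2) (d1 * d2))"
  "{\<rho> \<in> space (random_state (d1 * d2) s). trace_norm (realign d1 d2 \<rho>) \<le> 1} \<in> sets (borel_mat (d1 * d2) (d1 * d2))"
proof -
  note [measurable] = measurable_trace_norm[OF entrywise_measurable_realign[of d1 d2]]
  have sp: "space (random_state (d1 * d2) s) = space (borel_mat (d1 * d2) (d1 * d2))"
    by (simp add: random_state_def)
  show "{\<rho> \<in> space (random_state (d1 * d2) s). trace_norm (realign d1 d2 \<rho>) > 1} \<in> sets (borel_mat (d1 * d2) (d1 * d2))"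
    unfolding sp by measurable
  show "{\<rho> \<in> space (random_state (d1 * d2) s). trace_norm (realign d1 d2 \<rho>) \<le> 1} \<in> sets (borel_mat (d1 * d2) (d1 * d2))"
    unfolding sp by measurable
qed

lemma state_of_in_space: "state_of (d1 * d2) s x \<in> space (random_state (d1 * d2) s)"
  by (simp add: random_state_def borel_mat_def state_of_def)

theorem theorem7p1:
  fixes d1 s :: nat
  assumes "d1 > 0" and "s > 0"
  shows "\<exists>C c :: real. C > 0 \<and> c > 0 \<and> (\<forall>d2 :: nat. d2 > d1 \<longrightarrow>
    (s < d1\<^sup>2 \<longrightarrow>
      \<P>(\<rho> in random_state (d1 * d2) s. trace_norm (realign d1 d2 \<rho>) > 1)
        \<ge> 1 - C * exp (- c * real d2 powr (1 / 4))) \<and>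
    (s > d1\<^sup>2 \<longrightarrow>
      \<P>(\<rho> in random_state (d1 * d2) s. trace_norm (realign d1 d2 \<rho>) \<le> 1)
        \<ge> 1 - C * exp (- c * real d2 powr (1 / 4))))"
proof -
  obtain \<epsilon> where \<epsilon>: "\<epsilon> > 0"
    and gt: "\<And>d2 x. s < d1\<^sup>2 \<Longrightarrow> \<forall>p\<in>{..<d1} \<times> {..<s}. \<forall>q\<in>{..<d1} \<times> {..<s}.
      cmod (row_gram d2 s x p q - isotropic (d1 * s) p q) < \<epsilon> \<Longrightarrow>
      trace_norm (realign d1 d2 (state_of (d1 * d2) s x)) > 1"
    and le: "\<And>d2 x. s > d1\<^sup>2 \<Longrightarrow> \<forall>p\<in>{..<d1} \<times> {..<s}. \<forall>q\<in>{..<d1} \<times> {..<s}.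
      cmod (row_gram d2 s x p q - isotropic (d1 * s) p q) < \<epsilon> \<Longrightarrow>
      trace_norm (realign d1 d2 (state_of (d1 * d2) s x)) \<le> 1"
  proof -
    consider "s < d1\<^sup>2" | "s > d1\<^sup>2" | "s = d1\<^sup>2" by linarith
    thus thesis
    proof cases
      case 1
      with trace_norm_gt_1_near_isotropic[OF assms] that show ?thesis by (metis order.asym)
    next
      case 2
      with trace_norm_le_1_near_isotropic[OF assms] that show ?thesis by (metis order.asym)
    next
      case 3
      with that[of 1] show ?thesis by simp
    qed
  qed
  \<comment> \<open>If \<open>s = d1^2\<close>, nothing is claimed and any \<open>\<epsilon>\<close> serves; otherwise \<open>\<epsilon>\<close> is the one of the relevant case.\<close>
  define \<eta> where "\<eta> = min (1/2) (\<epsilon> / 8)"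
  have \<eta>: "0 < \<eta>" "\<eta> \<le> 1/2" "8 * \<eta> \<le> \<epsilon>" using \<epsilon> by (auto simp: \<eta>_def)
  define C c where "C = 4 * (real (d1 * s))\<^sup>2" and "c = \<eta>\<^sup>2 / 8"
  have C: "C > 0" and c: "c > 0" using assms \<eta> by (auto simp: C_def c_def)
  have tail: "1 - C * exp (- c * real d2 powr (1 / 4)) \<le> 1 - 4 * (d1 * s)\<^sup>2 * exp (- (\<eta>\<^sup>2 / 8) * d2)"
    if "d2 > d1" for d2
  proof -
    have "real d2 powr (1 / 4) \<le> real d2 powr 1" using that by (intro powr_mono) auto
    hence "c * real d2 powr (1 / 4) \<le> c * real d2" using c that by (intro mult_left_mono) auto
    hence "exp (- c * d2) \<le> exp (- c * real d2 powr (1 / 4))" by simp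
    hence "C * exp (- c * d2) \<le> C * exp (- c * real d2 powr (1 / 4))" using C by (intro mult_left_mono) auto
    thus ?thesis by (simp add: C_def c_def)
  qed
  show ?thesis
  proof (rule exI[of _ C], rule exI[of _ c], intro conjI allI impI C c)
    fix d2 assume d2: "d2 > d1" and "s < d1\<^sup>2"
    have "1 - 4 * (d1 * s)\<^sup>2 * exp (- (\<eta>\<^sup>2 / 8) * d2)
      \<le> measure (random_state (d1 * d2) s) {\<rho> \<in> space (random_state (d1 * d2) s). trace_norm (realign d1 d2 \<rho>) > 1}"
      using assms d2 gt[OF \<open>s < d1\<^sup>2\<close>] state_of_in_space
      by (intro random_state_prob[OF _ _ _ \<epsilon> \<eta> trace_norm_realign_events(1)]) auto
    with tail[OF d2] show "\<P>(\<rho> in random_state (d1 * d2) s. trace_norm (realign d1 d2 \<rho>) > 1)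
        \<ge> 1 - C * exp (- c * real d2 powr (1 / 4))" by linarith
  next
    fix d2 assume d2: "d2 > d1" and "s > d1\<^sup>2"
    have "1 - 4 * (d1 * s)\<^sup>2 * exp (- (\<eta>\<^sup>2 / 8) * d2)
      \<le> measure (random_state (d1 * d2) s) {\<rho> \<in> space (random_state (d1 * d2) s). trace_norm (realign d1 d2 \<rho>) \<le> 1}"
      using assms d2 le[OF \<open>s > d1\<^sup>2\<close>] state_of_in_space
      by (intro random_state_prob[OF _ _ _ \<epsilon> \<eta> trace_norm_realign_events(2)]) auto
    with tail[OF d2] show "\<P>(\<rho> in random_state (d1 * d2) s. trace_norm (realign d1 d2 \<rho>) \<le> 1)
        \<ge> 1 - C * exp (- c * real d2 powr (1 / 4))" by linarith
  qed
qed

end
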